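(* Let $(M,\Omega,\theta)$ be a closed connected locally conformally symplectic (LCS) manifold of the first kind. Then $$\operatorname{cat}(M,[\theta])=0,$$ where $[\theta]\in H^1(M;\mathbb R)$ is the Lee class.
   Context: Closed manifold means compact without boundary. LCS manifolds: let $M$ be a smooth manifold of dimension $2n$, $n\geq 2$. An LCS structure on $M$ is a nondegenerate smooth two-form $\Omega$ for which there exists a closed one-form $\theta$ with $d\Omega=\theta\wedge\Omega$. The form $\theta$ is uniquely determined by $\Omega$ and is called the Lee form; $[\theta]\in H^1(M;\mathbb R)$ is the Lee class. The triple $(M,\Omega,\theta)$ is called an LCS manifold. First and second kind: let $\mathfrak X(M,\Omega)=\{X\in\mathfrak X(M)\mid \mathcal L_X\Omega=0\}$. For $X\in\mathfrak X(M,\Omega)$ the function $\theta(X)$ is constant, so $\ell(X)=\theta(X)$ defines a linear map (Lie algebra homomorphism) $\ell\colon\mathfrak X(M,\Omega)\to\mathbb R$. The LCS structure is of the first kind if $\ell\neq 0$ (equivalently $\ell$ is surjective), and of the second kind if $\ell$ is identically zero. Category of a degree-one class (Farber): let $M$ be a closed connected smooth manifold, $\xi\in H^1(M;\mathbb R)$, and let $\omega$ be a closed one-form representing $\xi$. For a continuous path $\gamma\colon[0,1]\to M$, the integral $\int_\gamma\omega$ is defined by choosing a subdivision $0=t_0<\cdots<t_m=1$ and open sets $U_i\supset\gamma([t_i,t_{i+1}])$ on which $\omega=df_{U_i}$, and setting $\int_\gamma\omega=\sum_{i=0}^{m-1}\bigl(f_{U_i}(\gamma(t_{i+1}))-f_{U_i}(\gamma(t_i))\bigr)$;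 this is independent of choices. For $N>0$, a subset $A\subset M$ is $N$-movable with respect to $\omega$ if there is a homotopy $h_t\colon A\to M$, $t\in[0,1]$, with $h_0$ the inclusion and $\int_{\gamma_x}\omega\leq -N$ for every $x\in A$, where $\gamma_x(t)=h_t(x)$. Then $\operatorname{cat}(M,\xi)$ is the least integer $k\geq 0$ such that for every $N>0$ there is an open cover $M=F\cup F_1\cup\cdots\cup F_k$ where $F$ is $N$-movable with respect to $\omega$ and each inclusion $F_i\hookrightarrow M$ ($i=1,\ldots,k$) is null-homotopic. This number depends only on $\xi$, not on the chosen representative $\omega$. *)

theory Defs
  imports "HOL-Analysis.Analysis" "HOL-Library.Extended_Nat"
begin

section \<open>Smooth maps and smooth manifolds\<close>

text \<open>\<open>Ck_on k S f\<close> is meaningful for open \<open>S\<close>, the only case used: the derivatives are taken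
  with respect to full neighbourhoods.\<close>

primrec Ck_on :: "nat \<Rightarrow> 'e::real_normed_vector set \<Rightarrow> ('e \<Rightarrow> 'f::real_normed_vector) \<Rightarrow> bool" where
  "Ck_on 0 S f \<longleftrightarrow> continuous_on S f"
| "Ck_on (Suc k) S f \<longleftrightarrow>
     (\<forall>x\<in>S. f differentiable (at x)) \<and> (\<forall>v. Ck_on k S (\<lambda>x. frechet_derivative f (at x) v))"

definition smooth_on :: "'e::real_normed_vector set \<Rightarrow> ('e \<Rightarrow> 'f::real_normed_vector) \<Rightarrow> bool" where
  "smooth_on S f \<longleftrightarrow> (\<forall>k. Ck_on k S f)"

text \<open>A chart is a pair of its domain and its coordinate map; the values of the coordinate map
  outside the domain are irrelevant.\<close>

type_synonym ('a, 'e) chart = "'a set \<times> ('a \<Rightarrow> 'e)"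

definition is_chart :: "'a topology \<Rightarrow> ('a, 'e::euclidean_space) chart \<Rightarrow> bool" where
  "is_chart M c \<longleftrightarrow> openin M (fst c) \<and> open (snd c ` fst c) \<and>
     homeomorphic_map (subtopology M (fst c)) (top_of_set (snd c ` fst c)) (snd c)"

definition chart_inv :: "('a, 'e) chart \<Rightarrow> 'e \<Rightarrow> 'a" where
  "chart_inv c = inv_into (fst c) (snd c)"

definition transition :: "('a, 'e) chart \<Rightarrow> ('a, 'e) chart \<Rightarrow> 'e \<Rightarrow> 'e" where
  "transition c d = snd d \<circ> chart_inv c"

text \<open>Charts take values in open subsets of the model space, so there is no boundary.
  The dimension is \<open>DIM('e)\<close>. The atlas need not be maximal.\<close>

definition smooth_manifold :: "'a topology \<Rightarrow> ('a, 'e::euclidean_space) chart set \<Rightarrow> bool" where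
  "smooth_manifold M A \<longleftrightarrow>
     Hausdorff_space M \<and> second_countable M \<and>
     (\<forall>c\<in>A. is_chart M c) \<and> (\<Union>c\<in>A. fst c) = topspace M \<and>
     (\<forall>c\<in>A. \<forall>d\<in>A. smooth_on (snd c ` (fst c \<inter> fst d)) (transition c d))"

definition smooth_function ::
  "('a, 'e::euclidean_space) chart set \<Rightarrow> 'a set \<Rightarrow> ('a \<Rightarrow> real) \<Rightarrow> bool" where
  "smooth_function A U f \<longleftrightarrow> (\<forall>c\<in>A. smooth_on (snd c ` (fst c \<inter> U)) (f \<circ> chart_inv c))"


section \<open>Vector fields and differential forms\<close>

text \<open>A tensor field is given by its local representatives: to each chart \<open>c\<close> of the atlas it assigns
  a tensor field on the open set \<open>snd c ` fst c\<close> of the model space, and the representatives in two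
  charts are related by the differential of the transition map. Only the values at charts of the
  atlas and at points of the images of these charts are relevant.\<close>

type_synonym ('a, 'e) vec_field = "('a, 'e) chart \<Rightarrow> 'e \<Rightarrow> 'e"
type_synonym ('a, 'e) form1 = "('a, 'e) chart \<Rightarrow> 'e \<Rightarrow> 'e \<Rightarrow> real"
type_synonym ('a, 'e) form2 = "('a, 'e) chart \<Rightarrow> 'e \<Rightarrow> 'e \<Rightarrow> 'e \<Rightarrow> real"
type_synonym ('a, 'e) form3 = "('a, 'e) chart \<Rightarrow> 'e \<Rightarrow> 'e \<Rightarrow> 'e \<Rightarrow> 'e \<Rightarrow> real"

definition vector_field ::
  "('a, 'e::euclidean_space) chart set \<Rightarrow> ('a, 'e) vec_field \<Rightarrow> bool" where
  "vector_field A X \<longleftrightarrow>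
     (\<forall>c\<in>A. smooth_on (snd c ` fst c) (X c)) \<and>
     (\<forall>c\<in>A. \<forall>d\<in>A. \<forall>x\<in>snd c ` (fst c \<inter> fst d).
        X d (transition c d x) = frechet_derivative (transition c d) (at x) (X c x))"

definition one_form ::
  "('a, 'e::euclidean_space) chart set \<Rightarrow> ('a, 'e) form1 \<Rightarrow> bool" where
  "one_form A \<omega> \<longleftrightarrow>
     (\<forall>c\<in>A. (\<forall>x\<in>snd c ` fst c. linear (\<omega> c x)) \<and>
             (\<forall>v. smooth_on (snd c ` fst c) (\<lambda>x. \<omega> c x v))) \<and>
     (\<forall>c\<in>A. \<forall>d\<in>A. \<forall>x\<in>snd c ` (fst c \<inter> fst d). \<forall>v.
        \<omega> c x v = \<omega> d (transition c d x) (frechet_derivative (transition c d) (at x) v))"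

definition two_form ::
  "('a, 'e::euclidean_space) chart set \<Rightarrow> ('a, 'e) form2 \<Rightarrow> bool" where
  "two_form A \<Omega> \<longleftrightarrow>
     (\<forall>c\<in>A. (\<forall>x\<in>snd c ` fst c. bilinear (\<Omega> c x) \<and> (\<forall>v. \<Omega> c x v v = 0)) \<and>
             (\<forall>v w. smooth_on (snd c ` fst c) (\<lambda>x. \<Omega> c x v w))) \<and>
     (\<forall>c\<in>A. \<forall>d\<in>A. \<forall>x\<in>snd c ` (fst c \<inter> fst d). \<forall>v w.
        \<Omega> c x v w = \<Omega> d (transition c d x)
          (frechet_derivative (transition c d) (at x) v)
          (frechet_derivative (transition c d) (at x) w))"

definition nondegenerate ::
  "('a, 'e::euclidean_space) chart set \<Rightarrow> ('a, 'e) form2 \<Rightarrow> bool" where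
  "nondegenerate A \<Omega> \<longleftrightarrow>
     (\<forall>c\<in>A. \<forall>x\<in>snd c ` fst c. \<forall>v. (\<forall>w. \<Omega> c x v w = 0) \<longrightarrow> v = 0)"

text \<open>Exterior derivatives and the wedge product, in the normalisation without factorials
  (\<open>d\<omega>(u,v) = u \<omega>(v) - v \<omega>(u) - \<omega>([u,v])\<close>). The formulas in a chart are the invariant ones
  evaluated on constant, hence commuting, vector fields.\<close>

definition d0 :: "('a \<Rightarrow> real) \<Rightarrow> ('a, 'e::euclidean_space) form1" where
  "d0 f c x v = frechet_derivative (f \<circ> chart_inv c) (at x) v"

definition d1 :: "('a, 'e::euclidean_space) form1 \<Rightarrow> ('a, 'e) form2" where
  "d1 \<omega> c x u v =
     frechet_derivative (\<lambda>y. \<omega> c y v) (at x) u - frechet_derivative (\<lambda>y. \<omega> c y u) (at x) v"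

definition d2 :: "('a, 'e::euclidean_space) form2 \<Rightarrow> ('a, 'e) form3" where
  "d2 \<Omega> c x u v w =
     frechet_derivative (\<lambda>y. \<Omega> c y v w) (at x) u
     - frechet_derivative (\<lambda>y. \<Omega> c y u w) (at x) v
     + frechet_derivative (\<lambda>y. \<Omega> c y u v) (at x) w"

definition wedge12 :: "('a, 'e) form1 \<Rightarrow> ('a, 'e) form2 \<Rightarrow> ('a, 'e) form3" where
  "wedge12 \<omega> \<Omega> c x u v w =
     \<omega> c x u * \<Omega> c x v w - \<omega> c x v * \<Omega> c x u w + \<omega> c x w * \<Omega> c x u v"

text \<open>The Lie derivative in a chart: \<open>(L\<^sub>X \<Omega>)(v,w) = X \<Omega>(v,w) - \<Omega>([X,v],w) - \<Omega>(v,[X,w])\<close> for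
  constant \<open>v\<close> and \<open>w\<close>, for which \<open>[X,v] = - DX(v)\<close>.\<close>

definition lie_derivative2 ::
  "('a, 'e::euclidean_space) vec_field \<Rightarrow> ('a, 'e) form2 \<Rightarrow> ('a, 'e) form2" where
  "lie_derivative2 X \<Omega> c x v w =
     frechet_derivative (\<lambda>y. \<Omega> c y v w) (at x) (X c x)
     + \<Omega> c x (frechet_derivative (X c) (at x) v) w
     + \<Omega> c x v (frechet_derivative (X c) (at x) w)"

definition closed_one_form ::
  "('a, 'e::euclidean_space) chart set \<Rightarrow> ('a, 'e) form1 \<Rightarrow> bool" where
  "closed_one_form A \<omega> \<longleftrightarrow> one_form A \<omega> \<and> (\<forall>c\<in>A. \<forall>x\<in>snd c ` fst c. \<forall>u v. d1 \<omega> c x u v = 0)"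

definition cohomologous ::
  "'a topology \<Rightarrow> ('a, 'e::euclidean_space) chart set \<Rightarrow> (('a, 'e) form1 \<times> ('a, 'e) form1) set" where
  "cohomologous M A = {(\<omega>, \<eta>). closed_one_form A \<omega> \<and> closed_one_form A \<eta> \<and>
     (\<exists>f. smooth_function A (topspace M) f \<and>
          (\<forall>c\<in>A. \<forall>x\<in>snd c ` fst c. \<forall>v. \<eta> c x v = \<omega> c x v + d0 f c x v))}"

text \<open>The first de Rham cohomology consists of the equivalence classes of closed one-forms.\<close>

definition cohomology_class ::
  "'a topology \<Rightarrow> ('a, 'e::euclidean_space) chart set \<Rightarrow> ('a, 'e) form1 \<Rightarrow> ('a, 'e) form1 set" where
  "cohomology_class M A \<omega> = cohomologous M A `` {\<omega>}"


section \<open>Locally conformally symplectic manifolds\<close>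

definition lcs_manifold ::
  "'a topology \<Rightarrow> ('a, 'e::euclidean_space) chart set \<Rightarrow> ('a, 'e) form2 \<Rightarrow> ('a, 'e) form1 \<Rightarrow> bool" where
  "lcs_manifold M A \<Omega> \<theta> \<longleftrightarrow>
     smooth_manifold M A \<and> (\<exists>n\<ge>2. DIM('e) = 2 * n) \<and>
     two_form A \<Omega> \<and> nondegenerate A \<Omega> \<and> closed_one_form A \<theta> \<and>
     (\<forall>c\<in>A. \<forall>x\<in>snd c ` fst c. \<forall>u v w. d2 \<Omega> c x u v w = wedge12 \<theta> \<Omega> c x u v w)"

definition infinitesimal_automorphisms ::
  "('a, 'e::euclidean_space) chart set \<Rightarrow> ('a, 'e) form2 \<Rightarrow> ('a, 'e) vec_field set" where
  "infinitesimal_automorphisms A \<Omega> = {X. vector_field A X \<and>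
     (\<forall>c\<in>A. \<forall>x\<in>snd c ` fst c. \<forall>v w. lie_derivative2 X \<Omega> c x v w = 0)}"

text \<open>The value of the function \<open>\<theta>(X)\<close>, which is constant on a connected LCS manifold if \<open>X\<close> is an
  infinitesimal automorphism.\<close>

definition lee_hom ::
  "('a, 'e::euclidean_space) chart set \<Rightarrow> ('a, 'e) form1 \<Rightarrow> ('a, 'e) vec_field \<Rightarrow> real" where
  "lee_hom A \<theta> X = (THE r. \<forall>c\<in>A. \<forall>x\<in>snd c ` fst c. \<theta> c x (X c x) = r)"

definition lcs_first_kind ::
  "('a, 'e::euclidean_space) chart set \<Rightarrow> ('a, 'e) form2 \<Rightarrow> ('a, 'e) form1 \<Rightarrow> bool" where
  "lcs_first_kind A \<Omega> \<theta> \<longleftrightarrow> (\<exists>X\<in>infinitesimal_automorphisms A \<Omega>. lee_hom A \<theta> X \<noteq> 0)"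


section \<open>The category of a degree-one class\<close>

definition primitive_on ::
  "('a, 'e::euclidean_space) chart set \<Rightarrow> ('a, 'e) form1 \<Rightarrow> 'a set \<Rightarrow> ('a \<Rightarrow> real) \<Rightarrow> bool" where
  "primitive_on A \<omega> U f \<longleftrightarrow> smooth_function A U f \<and>
     (\<forall>c\<in>A. \<forall>x\<in>snd c ` (fst c \<inter> U). \<forall>v. \<omega> c x v = d0 f c x v)"

definition has_form_integral ::
  "'a topology \<Rightarrow> ('a, 'e::euclidean_space) chart set \<Rightarrow> ('a, 'e) form1 \<Rightarrow> (real \<Rightarrow> 'a) \<Rightarrow> real \<Rightarrow> bool"
where
  "has_form_integral M A \<omega> \<gamma> I \<longleftrightarrow>
     (\<exists>(m::nat) (t :: nat \<Rightarrow> real) (U :: nat \<Rightarrow> 'a set) (f :: nat \<Rightarrow> 'a \<Rightarrow> real).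
        t 0 = 0 \<and> t m = 1 \<and>
        (\<forall>i<m. t i < t (Suc i) \<and> openin M (U i) \<and> \<gamma> ` {t i..t (Suc i)} \<subseteq> U i \<and>
               primitive_on A \<omega> (U i) (f i)) \<and>
        I = (\<Sum>i<m. f i (\<gamma> (t (Suc i))) - f i (\<gamma> (t i))))"

definition form_integral ::
  "'a topology \<Rightarrow> ('a, 'e::euclidean_space) chart set \<Rightarrow> ('a, 'e) form1 \<Rightarrow> (real \<Rightarrow> 'a) \<Rightarrow> real"
where
  "form_integral M A \<omega> \<gamma> = (THE I. has_form_integral M A \<omega> \<gamma> I)"

definition movable ::
  "'a topology \<Rightarrow> ('a, 'e::euclidean_space) chart set \<Rightarrow> ('a, 'e) form1 \<Rightarrow> real \<Rightarrow> 'a set \<Rightarrow> bool"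
where
  "movable M A \<omega> N S \<longleftrightarrow> S \<subseteq> topspace M \<and>
     (\<exists>h. continuous_map (prod_topology (top_of_set {0..1}) (subtopology M S)) M h \<and>
          (\<forall>x\<in>S. h (0, x) = x \<and> form_integral M A \<omega> (\<lambda>t. h (t, x)) \<le> - N))"

definition null_homotopic_in :: "'a topology \<Rightarrow> 'a set \<Rightarrow> bool" where
  "null_homotopic_in M S \<longleftrightarrow> (\<exists>a. homotopic_with (\<lambda>_. True) (subtopology M S) M (\<lambda>x. x) (\<lambda>_. a))"

definition has_cat_covers ::
  "'a topology \<Rightarrow> ('a, 'e::euclidean_space) chart set \<Rightarrow> ('a, 'e) form1 \<Rightarrow> nat \<Rightarrow> bool" where
  "has_cat_covers M A \<omega> k \<longleftrightarrow>
     (\<forall>N>0. \<exists>F (G :: nat \<Rightarrow> 'a set).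
        topspace M = F \<union> (\<Union>i\<in>{1..k}. G i) \<and>
        openin M F \<and> movable M A \<omega> N F \<and>
        (\<forall>i\<in>{1..k}. openin M (G i) \<and> null_homotopic_in M (G i)))"

text \<open>A representative of the class is chosen by \<open>SOME\<close>; on a closed manifold all representatives
  give the same value. The infimum in \<open>enat\<close> is the least \<open>k\<close>, and would be infinite if
  there were none.\<close>

definition class_cat ::
  "'a topology \<Rightarrow> ('a, 'e::euclidean_space) chart set \<Rightarrow> ('a, 'e) form1 set \<Rightarrow> enat" where
  "class_cat M A \<xi> = (INF k\<in>{k. has_cat_covers M A (SOME \<omega>. \<omega> \<in> \<xi>) k}. enat k)"

end

theory Submission imports Defs begin

text \<open>Let \<open>X\<close> be an infinitesimal automorphism with \<open>\<ell>(X) \<noteq> 0\<close>. Since \<open>\<theta>(X)\<close> is a constant, it equals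
  \<open>\<ell>(X)\<close>, so \<open>\<theta>\<close> vanishes nowhere. Instead of the flow of a multiple of \<open>X\<close>, the homotopy moving \<open>M\<close>
  is built from chart-local translations, damped by a bump function, in directions on which
  \<open>\<theta>\<close> is negative. By compactness finitely many of them compose to a homotopy along
  which the integral of \<open>\<theta>\<close> drops by a uniform \<open>\<delta> > 0\<close>, and iterating gives an arbitrarily large
  drop. Another representative \<open>\<theta> + dg\<close> changes the integrals by a bounded amount, so all of \<open>M\<close> is
  \<open>N\<close>-movable for every \<open>N\<close>.\<close>

subsection \<open>Calculus in the model space\<close>

text \<open>The hypothesis and the conclusion pass through \<open>THE\<close> and
  \<open>SOME\<close>. That \<open>lee_hom\<close> is nonzero says something about
  \<open>\<theta>\<close> only once \<open>\<theta>(X)\<close> is known to be constant; the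
  uniqueness of \<open>form_integral\<close> has to be proved before any integral can be estimated;
  and \<open>class_cat\<close> evaluates an arbitrary closed form in the class, which may vanish
  somewhere even though \<open>\<theta>\<close> does not. Hence the movements are always built for
  \<open>\<theta>\<close>, and only their integrals are transferred. The homotopy uses the nowhere
  zero form rather than \<open>X\<close> itself: a translation inside a ball needs just a primitive
  on that ball and the mean value theorem in one variable. The price is that each such motion lowers
  the integral only near one point, so strict decrease must survive composition before compactness
  can make it uniform.\<close>

lemma second_difference_bound:
  fixes g :: "'e::real_normed_vector \<Rightarrow> real"
  assumes "open S" "x \<in> S"
    and g: "\<And>y. y \<in> S \<Longrightarrow> (g has_derivative g' y) (at y)"
    and P: "((\<lambda>y. g' y u) has_derivative P) (at x)"
    and "e > 0"
  shows "\<forall>\<^sub>F t in at_right 0.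
    \<bar>g (x + t *\<^sub>R u + t *\<^sub>R v) - g (x + t *\<^sub>R u) - g (x + t *\<^sub>R v) + g x - t\<^sup>2 * P v\<bar> \<le> e * t\<^sup>2"
proof -
  interpret P: bounded_linear P using P by (rule has_derivative_bounded_linear)
  define B where "B = norm u + norm v + 1"
  have B: "B > 0" by (simp add: B_def add_nonneg_pos)
  \<comment> \<open>The estimate \<open>lin\<close> is used twice, each time with error
    \<open>e' * (t * B)\<close>; with this \<open>e'\<close> the two add up to
    \<open>e * t\<close>.\<close>
  define e' where "e' = e / (2 * B)"
  have e': "e' > 0" using B \<open>e > 0\<close> by (simp add: e'_def)
  obtain d1 where d1: "d1 > 0" "\<And>y. norm (y - x) < d1 \<Longrightarrow> \<bar>g' y u - g' x u - P (y - x)\<bar> \<le> e' * norm (y - x)"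
    using P e' unfolding has_derivative_at_alt by (metis real_norm_def)
  obtain d2 where d2: "d2 > 0" "ball x d2 \<subseteq> S"
    using assms(1,2) openE by blast
  define d where "d = min d1 d2 / B"
  have d: "d > 0" using d1 d2 B by (simp add: d_def)
  have main: "\<bar>g (x + t *\<^sub>R u + t *\<^sub>R v) - g (x + t *\<^sub>R u) - g (x + t *\<^sub>R v) + g x - t\<^sup>2 * P v\<bar> \<le> e * t\<^sup>2"
    if t: "0 < t" "t < d" for t
  proof -
    have tB: "t * B < min d1 d2" using t B by (simp add: d_def field_simps)
    have near: "norm (s *\<^sub>R u + r *\<^sub>R v) \<le> t * B" if "0 \<le> s" "s \<le> t" "0 \<le> r" "r \<le> t" for s r
    proof -
      have "norm (s *\<^sub>R u + r *\<^sub>R v) \<le> s * norm u + r * norm v"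
        using norm_triangle_ineq[of "s *\<^sub>R u" "r *\<^sub>R v"] that by simp
      also have "\<dots> \<le> t * norm u + t * norm v"
        using that by (intro add_mono mult_right_mono) auto
      also have "\<dots> \<le> t * B" using t by (simp add: B_def algebra_simps)
      finally show ?thesis .
    qed
    have inS: "x + s *\<^sub>R u + r *\<^sub>R v \<in> S" if "0 \<le> s" "s \<le> t" "0 \<le> r" "r \<le> t" for s r
      using near[OF that] tB d2(2) by (auto simp: dist_norm subset_iff norm_minus_commute algebra_simps)
    have lin: "\<bar>g' (x + s *\<^sub>R u + r *\<^sub>R v) u - g' x u - (s * P u + r * P v)\<bar> \<le> e' * (t * B)"
      if "0 \<le> s" "s \<le> t" "0 \<le> r" "r \<le> t" for s r
    proof -
      have *: "x + s *\<^sub>R u + r *\<^sub>R v - x = s *\<^sub>R u + r *\<^sub>R v" by simp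
      have "\<bar>g' (x + s *\<^sub>R u + r *\<^sub>R v) u - g' x u - (s * P u + r * P v)\<bar>
          \<le> e' * norm (s *\<^sub>R u + r *\<^sub>R v)"
        using d1(2)[of "x + s *\<^sub>R u + r *\<^sub>R v"] near[OF that] tB unfolding *
        by (simp add: P.add P.scaleR)
      also have "\<dots> \<le> e' * (t * B)"
        using near[OF that] e' by (intro mult_left_mono) auto
      finally show ?thesis .
    qed
    \<comment> \<open>Mean value theorem for the increment of \<open>g\<close> in direction
      \<open>v\<close>, as a function of the displacement along \<open>u\<close>: the second
      difference becomes \<open>t\<close> times a difference of values of \<open>g' _ u\<close>,
      which differentiability at \<open>x\<close> alone controls. Writing
      \<open>0 *\<^sub>R v\<close> lets \<open>lin\<close> and \<open>der\<close> treat both ends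
      alike.\<close>
    define \<phi> where "\<phi> s = g (x + s *\<^sub>R u + t *\<^sub>R v) - g (x + s *\<^sub>R u + 0 *\<^sub>R v)" for s
    have der: "(\<phi> has_derivative (\<lambda>h. h * (g' (x + s *\<^sub>R u + t *\<^sub>R v) u - g' (x + s *\<^sub>R u + 0 *\<^sub>R v) u))) (at s)"
      if "0 \<le> s" "s \<le> t" for s
    proof -
      have "((\<lambda>s. g (x + s *\<^sub>R u + r *\<^sub>R v)) has_derivative (\<lambda>h. h * g' (x + s *\<^sub>R u + r *\<^sub>R v) u)) (at s)"
        if r: "0 \<le> r" "r \<le> t" for r
      proof -
        have G: "(g has_derivative g' (x + s *\<^sub>R u + r *\<^sub>R v)) (at (x + s *\<^sub>R u + r *\<^sub>R v))"
          using g inS \<open>0 \<le> s\<close> \<open>s \<le> t\<close> r by blast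
        interpret G: bounded_linear "g' (x + s *\<^sub>R u + r *\<^sub>R v)"
          using G by (rule has_derivative_bounded_linear)
        have "((\<lambda>s. g (x + s *\<^sub>R u + r *\<^sub>R v)) has_derivative (\<lambda>h. g' (x + s *\<^sub>R u + r *\<^sub>R v) (h *\<^sub>R u))) (at s)"
          by (rule has_derivative_compose[where f = "\<lambda>s. x + s *\<^sub>R u + r *\<^sub>R v" and x = s and g = g, OF _ G]) (auto intro!: derivative_eq_intros)
        then show ?thesis by (simp add: G.scaleR)
      qed
      from has_derivative_diff[OF this[of t] this[of 0]] t show ?thesis
        unfolding \<phi>_def by (simp add: algebra_simps)
    qed
    obtain s where s: "0 < s" "s < t"
      "\<phi> t - \<phi> 0 = (t - 0) * (g' (x + s *\<^sub>R u + t *\<^sub>R v) u - g' (x + s *\<^sub>R u + 0 *\<^sub>R v) u)"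
      using mvt_simple[of 0 t \<phi> "\<lambda>s h. h * (g' (x + s *\<^sub>R u + t *\<^sub>R v) u - g' (x + s *\<^sub>R u + 0 *\<^sub>R v) u)"] t
        der by (metis (no_types, lifting) atLeastAtMost_iff greaterThanLessThan_iff has_derivative_at_withinI)
    define D where "D = g' (x + s *\<^sub>R u + t *\<^sub>R v) u - g' (x + s *\<^sub>R u + 0 *\<^sub>R v) u"
    have "\<bar>D - t * P v\<bar> \<le> 2 * (e' * (t * B))"
    proof -
      have "\<bar>g' (x + s *\<^sub>R u + t *\<^sub>R v) u - g' x u - (s * P u + t * P v)\<bar> \<le> e' * (t * B)"
        "\<bar>g' (x + s *\<^sub>R u + 0 *\<^sub>R v) u - g' x u - (s * P u + 0 * P v)\<bar> \<le> e' * (t * B)"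
        using s t by (intro lin; simp)+
      then show ?thesis unfolding D_def abs_le_iff by linarith
    qed
    also have "\<dots> = e * t" using B by (simp add: e'_def)
    finally have "\<bar>t * (D - t * P v)\<bar> \<le> t * (e * t)"
      using t by (simp add: abs_mult)
    moreover have "g (x + t *\<^sub>R u + t *\<^sub>R v) - g (x + t *\<^sub>R u) - g (x + t *\<^sub>R v) + g x = t * D"
      using s(3) by (simp add: \<phi>_def D_def)
    ultimately show ?thesis by (simp add: power2_eq_square algebra_simps)
  qed
  show ?thesis
    unfolding eventually_at_right_field using d main by (intro exI[of _ d]) auto
qed

text \<open>The second difference is symmetric in \<open>u\<close> and \<open>v\<close>, and divided
  by \<open>t\<^sup>2\<close> it tends to \<open>P v\<close> as well as to \<open>Q u\<close>.
  Differentiability of the first derivatives at the single point \<open>x\<close> is enough for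
  this, and that is what contractions of forms supply later; the symmetry then plays the role of dd
  = 0.\<close>

lemma second_derivative_symmetric:
  fixes g :: "'e::real_normed_vector \<Rightarrow> real"
  assumes "open S" "x \<in> S"
    and g: "\<And>y. y \<in> S \<Longrightarrow> (g has_derivative g' y) (at y)"
    and P: "((\<lambda>y. g' y u) has_derivative P) (at x)"
    and Q: "((\<lambda>y. g' y v) has_derivative Q) (at x)"
  shows "P v = Q u"
proof (rule ccontr)
  assume "P v \<noteq> Q u"
  \<comment> \<open>With a third of the gap as tolerance, the two errors together stay strictly
    below the gap.\<close>
  then have e: "\<bar>P v - Q u\<bar> / 3 > 0" by simp
  note bound = second_difference_bound[where g = g and g' = g', OF assms(1,2) g _ e]
  have "\<forall>\<^sub>F t in at_right (0::real). False"
    using bound[OF _ P, of v, simplified] bound[OF _ Q, of u, simplified] eventually_at_right_less[of 0]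
  proof eventually_elim
    case (elim t)
    define D where "D = g (x + t *\<^sub>R u + t *\<^sub>R v) - g (x + t *\<^sub>R u) - g (x + t *\<^sub>R v) + g x"
    have "\<bar>D - t\<^sup>2 * P v\<bar> \<le> \<bar>P v - Q u\<bar> / 3 * t\<^sup>2" "\<bar>D - t\<^sup>2 * Q u\<bar> \<le> \<bar>P v - Q u\<bar> / 3 * t\<^sup>2"
      using elim by (simp_all add: D_def algebra_simps)
    then have "\<bar>t\<^sup>2 * P v - t\<^sup>2 * Q u\<bar> \<le> 2 / 3 * (\<bar>P v - Q u\<bar> * t\<^sup>2)"
      unfolding abs_le_iff by linarith
    moreover have "\<bar>t\<^sup>2 * P v - t\<^sup>2 * Q u\<bar> = \<bar>P v - Q u\<bar> * t\<^sup>2"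
      unfolding right_diff_distrib[symmetric] abs_mult by simp
    moreover have "\<bar>P v - Q u\<bar> * t\<^sup>2 > 0" using e elim by simp
    ultimately show False by linarith
  qed
  then show False by (simp add: trivial_limit_at_right_real)
qed

section \<open>The Poincare lemma on a convex open set\<close>

lemma linear_Basis_sum:
  fixes f :: "'e::euclidean_space \<Rightarrow> real"
  assumes "linear f"
  shows "f v = (\<Sum>b\<in>Basis. (v \<bullet> b) * f b)"
proof -
  have "f v = f (\<Sum>b\<in>Basis. (v \<bullet> b) *\<^sub>R b)" by (simp add: euclidean_representation)
  also have "\<dots> = (\<Sum>b\<in>Basis. (v \<bullet> b) * f b)"
    using assms by (simp add: linear_sum linear_scale)
  finally show ?thesis .
qed

text \<open>Differentiation under the integral sign in direction \<open>u\<close> gives the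
  integrand \<open>G\<close>, and closedness turns \<open>G x t u\<close> into the derivative of
  \<open>t * w (a + t *\<^sub>R (x - a)) u\<close> with respect to \<open>t\<close>. The fundamental
  theorem of calculus then leaves the boundary term \<open>w x u\<close>.\<close>

lemma has_derivative_segment_integral:
  fixes w :: "'e::euclidean_space \<Rightarrow> 'e \<Rightarrow> real"
  assumes S: "open S" "convex S" "a \<in> S" "x \<in> S"
    and lin: "\<And>y. y \<in> S \<Longrightarrow> linear (w y)"
    and der: "\<And>y v. y \<in> S \<Longrightarrow> ((\<lambda>z. w z v) has_derivative (\<lambda>u. w' y u v)) (at y)"
    and cont: "\<And>u v. continuous_on S (\<lambda>y. w' y u v)"
    and closed: "\<And>y u v. y \<in> S \<Longrightarrow> w' y u v = w' y v u"
  shows "((\<lambda>y. integral {0..1} (\<lambda>t. w (a + t *\<^sub>R (y - a)) (y - a))) has_derivative w x) (at x)"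
proof -
  have seg: "a + t *\<^sub>R (y - a) \<in> S" if "y \<in> S" "t \<in> {0..1}" for y t
  proof -
    have "a + t *\<^sub>R (y - a) = (1 - t) *\<^sub>R a + t *\<^sub>R y" by (simp add: algebra_simps)
    then show ?thesis using S that by (simp add: convex_alt)
  qed
  have w'lin: "bounded_linear (\<lambda>u. w' y u v)" if "y \<in> S" for y v
    using der[OF that] by (rule has_derivative_bounded_linear)
  \<comment> \<open>Differentiability only gives linearity in \<open>u\<close>; closedness exchanges
    the two slots and so gives it in \<open>v\<close>.\<close>
  have w'lin2: "linear (\<lambda>v. w' y u v)" if "y \<in> S" for y u
    using closed[OF that] w'lin[OF that, of u] by (simp add: bounded_linear.linear)
  have wexp: "w y v = (\<Sum>b\<in>Basis. (v \<bullet> b) * w y b)" if "y \<in> S" for y v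
    using linear_Basis_sum lin that by blast
  have w'exp: "w' y u v = (\<Sum>b\<in>Basis. (v \<bullet> b) * w' y u b)" if "y \<in> S" for y u v
    using linear_Basis_sum w'lin2 that by blast
  have wc: "continuous_on S (\<lambda>y. w y v)" for v
    using der by (meson continuous_at_imp_continuous_on has_derivative_continuous)
  define F where "F y t = w (a + t *\<^sub>R (y - a)) (y - a)" for y t
  define G where "G y t u = t * w' (a + t *\<^sub>R (y - a)) u (y - a) + w (a + t *\<^sub>R (y - a)) u" for y t u
  have Glin: "bounded_linear (G y t)" if "y \<in> S" "t \<in> {0..1}" for y t
    unfolding G_def using w'lin[OF seg[OF that]] lin[OF seg[OF that]]
    by (intro bounded_linear_add bounded_linear_const_mult)
       (auto simp: linear_conv_bounded_linear)
  have Fder: "((\<lambda>y. F y t) has_derivative G y t) (at y within S)" if yt: "y \<in> S" "t \<in> {0..1}" for y t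
  proof -
    let ?z = "a + t *\<^sub>R (y - a)"
    have z: "?z \<in> S" using seg yt by blast
    \<comment> \<open>Base point and argument both vary with \<open>y\<close>, while
      \<open>der\<close> covers a fixed argument; the expansion in the basis separates the
      two.\<close>
    have 1: "((\<lambda>y. \<Sum>b\<in>Basis. ((y - a) \<bullet> b) * w (a + t *\<^sub>R (y - a)) b) has_derivative
        (\<lambda>u. \<Sum>b\<in>Basis. ((y - a) \<bullet> b) * w' ?z (t *\<^sub>R u) b + (u \<bullet> b) * w ?z b)) (at y)"
    proof (rule has_derivative_sum)
      fix b :: 'e
      have "((\<lambda>y. w (a + t *\<^sub>R (y - a)) b) has_derivative (\<lambda>u. w' ?z (t *\<^sub>R u) b)) (at y)"
        by (rule has_derivative_compose[where f = "\<lambda>y. a + t *\<^sub>R (y - a)" and x = y and g = "\<lambda>y. w y b", OF _ der[OF z]]) (auto intro!: derivative_eq_intros)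
      moreover have "((\<lambda>y. (y - a) \<bullet> b) has_derivative (\<lambda>u. u \<bullet> b)) (at y)"
        by (auto intro!: derivative_eq_intros)
      ultimately show "((\<lambda>y. ((y - a) \<bullet> b) * w (a + t *\<^sub>R (y - a)) b) has_derivative
        (\<lambda>u. ((y - a) \<bullet> b) * w' ?z (t *\<^sub>R u) b + (u \<bullet> b) * w ?z b)) (at y)"
        using has_derivative_mult by blast
    qed
    have 2: "(\<lambda>u. \<Sum>b\<in>Basis. ((y - a) \<bullet> b) * w' ?z (t *\<^sub>R u) b + (u \<bullet> b) * w ?z b) = G y t"
    proof
      fix u
      show "(\<Sum>b\<in>Basis. ((y - a) \<bullet> b) * w' ?z (t *\<^sub>R u) b + (u \<bullet> b) * w ?z b) = G y t u"
        unfolding sum.distrib G_def wexp[OF z, of u, symmetric] w'exp[OF z, of "t *\<^sub>R u", symmetric]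
        using linear_scale[OF bounded_linear.linear[OF w'lin[OF z]]] by simp
    qed
    have "((\<lambda>y. \<Sum>b\<in>Basis. ((y - a) \<bullet> b) * w (a + t *\<^sub>R (y - a)) b) has_derivative G y t) (at y within S)"
      using 1 unfolding 2 by (rule has_derivative_at_withinI)
    then show ?thesis
      by (rule has_derivative_transform[OF yt(1), rotated]) (use wexp seg yt in \<open>auto simp: F_def\<close>)
  qed
  have Gc: "continuous_on (S \<times> {0..1}) (\<lambda>(y, t). G y t u)" for u
  proof -
    have m: "continuous_on (S \<times> {0..1}) (\<lambda>p. a + snd p *\<^sub>R (fst p - a))"
      by (intro continuous_intros)
    have im: "(\<lambda>p. a + snd p *\<^sub>R (fst p - a)) ` (S \<times> {0..1}) \<subseteq> S"
      using seg by auto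
    have "continuous_on (S \<times> {0..1}) (\<lambda>p. snd p * (\<Sum>b\<in>Basis. ((fst p - a) \<bullet> b) * w' (a + snd p *\<^sub>R (fst p - a)) u b)
        + w (a + snd p *\<^sub>R (fst p - a)) u)"
      by (intro continuous_intros continuous_on_compose2[OF cont m im] continuous_on_compose2[OF wc m im])
    then show ?thesis
      by (rule continuous_on_eq) (use w'exp seg in \<open>auto simp: G_def\<close>)
  qed
  have Fint: "F y integrable_on cbox 0 1" if "y \<in> S" for y
  proof -
    have "continuous_on {0..1} (\<lambda>t. \<Sum>b\<in>Basis. ((y - a) \<bullet> b) * w (a + t *\<^sub>R (y - a)) b)"
      using seg[OF that] by (intro continuous_intros continuous_on_compose2[OF wc]) auto
    then have "continuous_on {0..1} (F y)"
      by (rule continuous_on_eq) (use wexp seg that in \<open>auto simp: F_def\<close>)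
    then show ?thesis by (simp add: integrable_continuous_interval)
  qed
  \<comment> \<open>\<open>Blinfun\<close> is meaningful only on bounded linear maps, which
    \<open>G y t\<close> is for \<open>y\<close> in \<open>S\<close> and \<open>t\<close> in the
    unit interval; the Leibniz rule takes the derivative in this form.\<close>
  have BG: "blinfun_apply (Blinfun (G y t)) = G y t" if "y \<in> S" "t \<in> {0..1}" for y t
    using Glin[OF that] by (rule bounded_linear_Blinfun_apply)
  have Bc: "continuous_on (S \<times> cbox 0 1) (\<lambda>(y, t). Blinfun (G y t))"
  proof (rule continuous_on_blinfun_componentwise)
    fix i :: 'e
    show "continuous_on (S \<times> cbox 0 1) (\<lambda>x. blinfun_apply (case x of (y, t) \<Rightarrow> Blinfun (G y t)) i)"
      using Gc[of i] unfolding cbox_interval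
      by (rule continuous_on_eq) (auto simp: BG)
  qed
  have L: "((\<lambda>y. integral (cbox 0 1) (F y)) has_derivative
      integral (cbox 0 1) (\<lambda>t. Blinfun (G x t))) (at x within S)"
    by (rule leibniz_rule[OF _ Fint Bc S(4,2)]) (use Fder BG in auto)
  have BI: "(\<lambda>t. Blinfun (G x t)) integrable_on cbox 0 1"
  proof -
    have "continuous_on (cbox 0 1) (\<lambda>t. (\<lambda>(y, t). Blinfun (G y t)) (x, t))"
      by (rule continuous_on_compose2[OF Bc]) (use S in \<open>auto intro!: continuous_intros\<close>)
    then show ?thesis using integrable_continuous by fastforce
  qed
  have "blinfun_apply (integral (cbox 0 1) (\<lambda>t. Blinfun (G x t))) u = w x u" for u
  proof -
    have "blinfun_apply (integral (cbox 0 1) (\<lambda>t. Blinfun (G x t))) u =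
        integral (cbox 0 1) (\<lambda>t. blinfun_apply (Blinfun (G x t)) u)"
      by (rule integral_linear[OF BI blinfun.bounded_linear_left, unfolded o_def, symmetric])
    also have "\<dots> = integral {0..1} (\<lambda>t. G x t u)"
      by (rule integral_cong[THEN trans]) (use BG S in \<open>auto\<close>)
    also have "\<dots> = 1 * w (a + 1 *\<^sub>R (x - a)) u - 0 * w (a + 0 *\<^sub>R (x - a)) u"
    proof (rule integral_unique, rule fundamental_theorem_of_calculus)
      fix t :: real assume t: "t \<in> {0..1}"
      let ?z = "a + t *\<^sub>R (x - a)"
      have z: "?z \<in> S" using seg S t by blast
      have "((\<lambda>t. w (a + t *\<^sub>R (x - a)) u) has_derivative (\<lambda>h. w' ?z (h *\<^sub>R (x - a)) u)) (at t)"
        by (rule has_derivative_compose[where f = "\<lambda>t. a + t *\<^sub>R (x - a)" and x = t and g = "\<lambda>y. w y u", OF _ der[OF z]]) (auto intro!: derivative_eq_intros)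
      then have "((\<lambda>t. w (a + t *\<^sub>R (x - a)) u) has_vector_derivative w' ?z (x - a) u) (at t within {0..1})"
        using linear_scale[OF bounded_linear.linear[OF w'lin[OF z]]]
        by (simp add: has_vector_derivative_def has_derivative_at_withinI)
      then have "((\<lambda>t. t * w (a + t *\<^sub>R (x - a)) u) has_vector_derivative
          (t * w' ?z (x - a) u + 1 * w ?z u)) (at t within {0..1})"
        by (intro has_vector_derivative_mult has_vector_derivative_id)
      then show "((\<lambda>t. t * w (a + t *\<^sub>R (x - a)) u) has_vector_derivative G x t u) (at t within {0..1})"
        using closed[OF z, of u "x - a"] by (simp add: G_def)
    qed simp
    finally show ?thesis by simp
  qed
  then have "blinfun_apply (integral (cbox 0 1) (\<lambda>t. Blinfun (G x t))) = w x" by auto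
  with L have "((\<lambda>y. integral {0..1} (F y)) has_derivative w x) (at x within S)" by (simp add: cbox_interval)
  then show ?thesis unfolding F_def at_within_open[OF S(4,1)] .
qed

text \<open>If \<open>\<alpha> w\<close> were nonzero, dimension at least three would leave a
  nonzero \<open>u\<close> with \<open>\<alpha> u = 0\<close> and \<open>B u w = 0\<close>. The
  cyclic identity then reduces to \<open>\<alpha> w * B u v = 0\<close> for every \<open>v\<close>,
  against nondegeneracy. In dimension two the identity would be void.\<close>

lemma wedge_nondegenerate_eq_0:
  fixes B :: "'e::euclidean_space \<Rightarrow> 'e \<Rightarrow> real"
  assumes dim: "DIM('e) \<ge> 3"
    and B: "bilinear B" "\<And>v. B v v = 0" "\<And>v. (\<forall>w. B v w = 0) \<Longrightarrow> v = 0"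
    and \<alpha>: "linear \<alpha>" "\<And>u v w. \<alpha> w * B u v + \<alpha> u * B v w + \<alpha> v * B w u = 0"
  shows "\<alpha> w = 0"
proof (rule ccontr)
  assume w: "\<alpha> w \<noteq> 0"
  have Bl: "linear (\<lambda>u. B u v)" "linear (B v)" for v using B(1) by (auto simp: bilinear_def)
  \<comment> \<open>Vectors representing \<open>\<alpha>\<close> and
    \<open>\<lambda>u. B u w\<close> for the inner product, so that a vector orthogonal to both is a
    common zero.\<close>
  define a where "a = (\<Sum>b\<in>Basis. \<alpha> b *\<^sub>R b)"
  define b where "b = (\<Sum>c\<in>Basis. B c w *\<^sub>R c)"
  have a: "\<alpha> u = a \<bullet> u" for u
    by (subst linear_Basis_sum[OF \<alpha>(1)]) (auto simp: a_def inner_sum_left inner_commute[of u] mult.commute intro!: sum.cong)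
  have b: "B u w = b \<bullet> u" for u
    by (subst linear_Basis_sum[OF Bl(1)]) (auto simp: b_def inner_sum_left inner_commute[of u] mult.commute intro!: sum.cong)
  have "dim {a, b} \<le> card {a, b}" by (intro dim_le_card) (auto simp: span_superset)
  also have "\<dots> \<le> 2" by (simp add: card_insert_if)
  finally have "dim {a, b} < DIM('e)" using dim by simp
  then obtain u where u: "u \<noteq> 0" "\<And>y. y \<in> span {a, b} \<Longrightarrow> orthogonal u y"
    using orthogonal_to_subspace_exists by metis
  have au: "\<alpha> u = 0" and bu: "B u w = 0"
    using u(2)[of a] u(2)[of b] unfolding a b by (auto simp: orthogonal_def inner_commute span_base)
  have alt: "B x y = - B y x" for x y
    using B(2)[of "x + y"] B(2)[of x] B(2)[of y] linear_add[OF Bl(1)] linear_add[OF Bl(2)] by (simp add: algebra_simps)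
  have "B u v = 0" for v
    using \<alpha>(2)[of w u v] au bu w alt[of w u] by simp
  then show False using B(3) u by blast
qed

section \<open>Forms evaluated on vector fields\<close>

lemma smooth_onD:
  assumes "smooth_on S f"
  shows smooth_on_continuous: "continuous_on S f"
    and smooth_on_has_derivative: "x \<in> S \<Longrightarrow> (f has_derivative frechet_derivative f (at x)) (at x)"
    and smooth_on_frechet_derivative: "smooth_on S (\<lambda>x. frechet_derivative f (at x) v)"
proof -
  have "Ck_on k S f" for k using assms by (simp add: smooth_on_def)
  from this[of 0] this[of "Suc 0"] this[of "Suc k" for k]
  show "continuous_on S f" "x \<in> S \<Longrightarrow> (f has_derivative frechet_derivative f (at x)) (at x)"
    "smooth_on S (\<lambda>x. frechet_derivative f (at x) v)"
    by (auto simp: smooth_on_def simp flip: frechet_derivative_works)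
qed

text \<open>The smoothness of a form is stated for each fixed argument, so the moving argument
  \<open>X y\<close> is expanded in the basis; the fact \<open>D\<close> reassembles the coefficient
  derivatives into the derivative with the argument frozen at \<open>X x\<close>. It serves both for
  the function \<open>\<theta>(X)\<close> and for the contraction of \<open>\<Omega>\<close> with
  \<open>X\<close>.\<close>

lemma contraction_has_derivative:
  fixes \<omega> :: "'e::euclidean_space \<Rightarrow> 'e \<Rightarrow> real"
  assumes S: "open S" "x \<in> S"
    and lin: "\<And>y. y \<in> S \<Longrightarrow> linear (\<omega> y)"
    and \<omega>: "\<And>v. smooth_on S (\<lambda>y. \<omega> y v)"
    and X: "smooth_on S X"
  shows "((\<lambda>y. \<omega> y (X y)) has_derivative
    (\<lambda>u. frechet_derivative (\<lambda>y. \<omega> y (X x)) (at x) u + \<omega> x (frechet_derivative X (at x) u))) (at x)"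
proof -
  note exp = linear_Basis_sum[OF lin]
  let ?D = "\<lambda>b. frechet_derivative (\<lambda>y. \<omega> y b) (at x)"
  have "((\<lambda>y. \<Sum>b\<in>Basis. (a \<bullet> b) * \<omega> y b) has_derivative (\<lambda>u. \<Sum>b\<in>Basis. (a \<bullet> b) * ?D b u)) (at x)" for a
    by (intro has_derivative_sum has_derivative_mult_right smooth_on_has_derivative[OF \<omega> S(2)])
  then have "((\<lambda>y. \<omega> y a) has_derivative (\<lambda>u. \<Sum>b\<in>Basis. (a \<bullet> b) * ?D b u)) (at x)" for a
    by (rule has_derivative_transform_within_open[OF _ S]) (simp add: exp[of _ a])
  then have D: "?D a = (\<lambda>u. \<Sum>b\<in>Basis. (a \<bullet> b) * ?D b u)" for a
    by (rule frechet_derivative_at[symmetric])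
  have "((\<lambda>y. \<Sum>b\<in>Basis. (X y \<bullet> b) * \<omega> y b) has_derivative
      (\<lambda>u. \<Sum>b\<in>Basis. (X x \<bullet> b) * ?D b u + (frechet_derivative X (at x) u \<bullet> b) * \<omega> x b)) (at x)"
    by (intro has_derivative_sum has_derivative_mult has_derivative_inner_left
        smooth_on_has_derivative[OF \<omega> S(2)] smooth_on_has_derivative[OF X S(2)])
  then have "((\<lambda>y. \<omega> y (X y)) has_derivative
      (\<lambda>u. \<Sum>b\<in>Basis. (X x \<bullet> b) * ?D b u + (frechet_derivative X (at x) u \<bullet> b) * \<omega> x b)) (at x)"
    by (rule has_derivative_transform_within_open[OF _ S]) (simp add: exp[of _ "X _"])
  then show ?thesis
    unfolding sum.distrib exp[OF S(2), symmetric] D[of "X x", symmetric] fun_eq_iff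
    by (simp add: D[of "X x", symmetric, THEN fun_cong])
qed

lemma contraction_differentiable:
  fixes \<omega> :: "'e::euclidean_space \<Rightarrow> 'e \<Rightarrow> real"
  assumes "open S" "x \<in> S" "\<And>y. y \<in> S \<Longrightarrow> linear (\<omega> y)"
    and "\<And>v. smooth_on S (\<lambda>y. \<omega> y v)" and "smooth_on S X"
  shows "(\<lambda>y. \<omega> y (X y)) differentiable (at x)"
  using contraction_has_derivative[OF assms] differentiableI by blast

text \<open>Differentiating in a fixed direction leaves a family that is again linear in its
  argument. Hence \<open>contraction_differentiable\<close> also applies to the derivative of
  \<open>\<Omega>\<close>, and the contraction of \<open>\<Omega>\<close> with \<open>X\<close>
  becomes twice differentiable.\<close>

lemma linear_frechet_derivative_family:
  fixes \<omega> :: "'e::euclidean_space \<Rightarrow> 'e \<Rightarrow> real"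
  assumes S: "open S" "x \<in> S"
    and lin: "\<And>y. y \<in> S \<Longrightarrow> linear (\<omega> y)"
    and \<omega>: "\<And>v. smooth_on S (\<lambda>y. \<omega> y v)"
  shows "linear (\<lambda>v. frechet_derivative (\<lambda>y. \<omega> y v) (at x) u)"
proof (rule linearI)
  note d = smooth_on_has_derivative[OF \<omega> S(2)]
  fix a b and r :: real
  have "((\<lambda>y. \<omega> y (a + b)) has_derivative
      (\<lambda>u. frechet_derivative (\<lambda>y. \<omega> y a) (at x) u + frechet_derivative (\<lambda>y. \<omega> y b) (at x) u)) (at x)"
    by (rule has_derivative_transform_within_open[OF has_derivative_add[OF d d] S])
       (simp add: linear_add[OF lin])
  from frechet_derivative_at[OF this]
  show "frechet_derivative (\<lambda>y. \<omega> y (a + b)) (at x) u =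
      frechet_derivative (\<lambda>y. \<omega> y a) (at x) u + frechet_derivative (\<lambda>y. \<omega> y b) (at x) u" by metis
  have "((\<lambda>y. \<omega> y (r *\<^sub>R a)) has_derivative
      (\<lambda>u. r *\<^sub>R frechet_derivative (\<lambda>y. \<omega> y a) (at x) u)) (at x)"
    by (rule has_derivative_transform_within_open[OF has_derivative_scaleR_right[OF d] S])
       (simp add: linear_scale[OF lin])
  from frechet_derivative_at[OF this]
  show "frechet_derivative (\<lambda>y. \<omega> y (r *\<^sub>R a)) (at x) u =
      r *\<^sub>R frechet_derivative (\<lambda>y. \<omega> y a) (at x) u" by metis
qed

text \<open>For \<open>\<beta> = \<iota>\<^sub>X \<Omega>\<close> and \<open>f = \<theta>(X)\<close>, Cartan's formula turns \<open>L\<^sub>X \<Omega> = 0\<close> and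
  \<open>d\<Omega> = \<theta> \<and> \<Omega>\<close> into \<open>d\<beta> = \<theta> \<and> \<beta> - f \<Omega>\<close>; taking \<open>d\<close> once more leaves \<open>df \<and> \<Omega> = 0\<close>, which forces
  \<open>df = 0\<close> because \<open>\<Omega>\<close> is nondegenerate and the dimension is at least three.\<close>

lemma lee_pairing_has_derivative_0:
  fixes \<Omega> :: "'e::euclidean_space \<Rightarrow> 'e \<Rightarrow> 'e \<Rightarrow> real" and \<theta> :: "'e \<Rightarrow> 'e \<Rightarrow> real"
  assumes dim: "DIM('e) \<ge> 3" and S: "open S" "x \<in> S"
    and \<Omega>: "\<And>y. y \<in> S \<Longrightarrow> bilinear (\<Omega> y)" "\<And>y v. y \<in> S \<Longrightarrow> \<Omega> y v v = 0"
      "\<And>v w. smooth_on S (\<lambda>y. \<Omega> y v w)" "\<And>v. (\<forall>w. \<Omega> x v w = 0) \<Longrightarrow> v = 0"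
    and \<theta>: "\<And>y. y \<in> S \<Longrightarrow> linear (\<theta> y)" "\<And>v. smooth_on S (\<lambda>y. \<theta> y v)"
      "\<And>u v. frechet_derivative (\<lambda>y. \<theta> y v) (at x) u = frechet_derivative (\<lambda>y. \<theta> y u) (at x) v"
    and X: "smooth_on S X"
    and d\<Omega>: "\<And>y u v w. y \<in> S \<Longrightarrow> frechet_derivative (\<lambda>z. \<Omega> z v w) (at y) u
      - frechet_derivative (\<lambda>z. \<Omega> z u w) (at y) v + frechet_derivative (\<lambda>z. \<Omega> z u v) (at y) w
      = \<theta> y u * \<Omega> y v w - \<theta> y v * \<Omega> y u w + \<theta> y w * \<Omega> y u v"
    and L: "\<And>y v w. y \<in> S \<Longrightarrow> frechet_derivative (\<lambda>z. \<Omega> z v w) (at y) (X y)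
      + \<Omega> y (frechet_derivative X (at y) v) w + \<Omega> y v (frechet_derivative X (at y) w) = 0"
  shows "((\<lambda>y. \<theta> y (X y)) has_derivative (\<lambda>u. 0)) (at x)"
proof -
  define d\<Omega>' where "d\<Omega>' y u v w = frechet_derivative (\<lambda>z. \<Omega> z v w) (at y) u" for y u v w
  define dX where "dX y u = frechet_derivative X (at y) u" for y u
  define d\<theta> where "d\<theta> u v = frechet_derivative (\<lambda>z. \<theta> z v) (at x) u" for u v
  define f where "f y = \<theta> y (X y)" for y
  define df where "df u = d\<theta> u (X x) + \<theta> x (dX x u)" for u
  define \<beta> where "\<beta> y v = \<Omega> y (X y) v" for y v
  define d\<beta> where "d\<beta> y u v = d\<Omega>' y u (X y) v + \<Omega> y (dX y u) v" for y u v
  have lin: "linear (\<Omega> y v)" "linear (\<lambda>u. \<Omega> y u v)" if "y \<in> S" for y v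
    using \<Omega>(1)[OF that] by (auto simp: bilinear_def)
  have skew: "\<Omega> y v u = - \<Omega> y u v" if "y \<in> S" for y u v
    using \<Omega>(2)[OF that, of "u + v"] \<Omega>(2)[OF that, of u] \<Omega>(2)[OF that, of v]
      linear_add[OF lin(1)[OF that]] linear_add[OF lin(2)[OF that]] by (simp add: algebra_simps)
  have dskew: "d\<Omega>' y w v u = - d\<Omega>' y w u v" if "y \<in> S" for y u v w
  proof -
    have "((\<lambda>z. \<Omega> z v u) has_derivative (\<lambda>w. - d\<Omega>' y w u v)) (at y)"
      unfolding d\<Omega>'_def
      by (rule has_derivative_transform_within_open[OF has_derivative_minus
          [OF smooth_on_has_derivative[OF \<Omega>(3)[of u v] that]] S(1) that]) (simp add: skew[of _ v u])
    from frechet_derivative_at[OF this] show ?thesis unfolding d\<Omega>'_def by metis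
  qed
  have f': "(f has_derivative df) (at x)"
    using contraction_has_derivative[OF S \<theta>(1,2) X]
    by (simp add: f_def[abs_def] df_def[abs_def] dX_def d\<theta>_def)
  have \<beta>': "((\<lambda>y. \<beta> y v) has_derivative (\<lambda>u. d\<beta> y u v)) (at y)" if "y \<in> S" for y v
    using contraction_has_derivative[OF S(1) that lin(2) \<Omega>(3) X]
    by (simp add: \<beta>_def d\<beta>_def dX_def d\<Omega>'_def)
  \<comment> \<open>The fact \<open>d\<Omega>\<close> with \<open>X y\<close> in the first slot
    contains the derivative along \<open>X\<close>, which \<open>L\<close> replaces by terms in
    \<open>dX\<close>; these complete the two \<open>d\<beta>\<close> values.\<close>
  have E: "d\<beta> y u v - d\<beta> y v u = \<theta> y u * \<beta> y v - \<theta> y v * \<beta> y u - f y * \<Omega> y u v" if y: "y \<in> S" for y u v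
    using d\<Omega>[OF y, where u = "X y" and v = u and w = v] L[OF y, where v = u and w = v] skew[OF y, of "dX y v" u]
    by (simp add: \<beta>_def d\<beta>_def f_def flip: d\<Omega>'_def dX_def)
  have "(\<lambda>y. d\<Omega>' y u (X y) v + \<Omega> y (dX y u) v) differentiable (at x)" for u v
    unfolding d\<Omega>'_def dX_def
    by (intro differentiable_add contraction_differentiable[OF S _ _ X]
        contraction_differentiable[OF S lin(2) \<Omega>(3) smooth_on_frechet_derivative[OF X]]
        linear_frechet_derivative_family[OF S(1) _ lin(2)]
        smooth_on_frechet_derivative[OF \<Omega>(3)] \<Omega>(3))
  then have "(\<lambda>y. d\<beta> y u v) differentiable (at x)" for u v
    by (simp add: d\<beta>_def)
  then obtain R where R: "((\<lambda>y. d\<beta> y u v) has_derivative R u v) (at x)" for u v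
    unfolding differentiable_def by metis
  \<comment> \<open>The first and the last argument are the two directions of differentiation; the
    middle one is the slot of \<open>\<beta>\<close>.\<close>
  have Rsym: "R u v w = R w v u" for u v w
    using second_derivative_symmetric[where g = "\<lambda>y. \<beta> y v" and g' = "\<lambda>y u. d\<beta> y u v", OF S \<beta>' R R] .
  have dE: "R u v w - R v u w = (\<theta> x u * d\<beta> x w v + d\<theta> w u * \<beta> x v) - (\<theta> x v * d\<beta> x w u + d\<theta> w v * \<beta> x u)
      - (f x * d\<Omega>' x w u v + df w * \<Omega> x u v)" for u v w
  proof -
    have 1: "((\<lambda>y. \<theta> y u * \<beta> y v - \<theta> y v * \<beta> y u - f y * \<Omega> y u v) has_derivative
        (\<lambda>w. (\<theta> x u * d\<beta> x w v + d\<theta> w u * \<beta> x v) - (\<theta> x v * d\<beta> x w u + d\<theta> w v * \<beta> x u)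
          - (f x * d\<Omega>' x w u v + df w * \<Omega> x u v))) (at x)"
      unfolding d\<theta>_def d\<Omega>'_def
      by (intro has_derivative_diff has_derivative_mult \<beta>' f' S smooth_on_has_derivative[OF \<Omega>(3)]
          smooth_on_has_derivative[OF \<theta>(2)])
    have 2: "((\<lambda>y. \<theta> y u * \<beta> y v - \<theta> y v * \<beta> y u - f y * \<Omega> y u v) has_derivative
        (\<lambda>w. R u v w - R v u w)) (at x)"
      by (rule has_derivative_transform_within_open[OF has_derivative_diff[OF R R] S]) (simp add: E)
    from fun_cong[OF has_derivative_unique[OF 2 1], of w] show ?thesis .
  qed
  have wedge: "df w * \<Omega> x u v + df u * \<Omega> x v w + df v * \<Omega> x w u = 0" for u v w
  proof -
    \<comment> \<open>The cyclic sum of \<open>dE\<close> is the exterior derivative of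
      \<open>E\<close>. Its left side cancels by \<open>Rsym\<close>, the \<open>d\<theta>\<close>
      terms cancel by closedness, and replacing the differences of \<open>d\<beta>\<close> by means
      of \<open>E\<close> yields a multiple of \<theta> \<and> \<Omega> that cancels the
      \<open>d\<Omega>'\<close> terms. The products are supplied as whole equations because the
      final step is linear arithmetic in them.\<close>
    have "(R u v w - R v u w) + (R v w u - R w v u) + (R w u v - R u w v) = 0"
      using Rsym[of u v w] Rsym[of v u w] Rsym[of v w u] by simp
    moreover have "d\<theta> w u * \<beta> x v = d\<theta> u w * \<beta> x v" "d\<theta> w v * \<beta> x u = d\<theta> v w * \<beta> x u"
        "d\<theta> u v * \<beta> x w = d\<theta> v u * \<beta> x w"
      using \<theta>(3) by (simp_all add: d\<theta>_def)
    moreover have "f x * (d\<Omega>' x w u v + d\<Omega>' x u v w + d\<Omega>' x v w u)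
        = f x * (\<theta> x w * \<Omega> x u v + \<theta> x u * \<Omega> x v w + \<theta> x v * \<Omega> x w u)"
      using d\<Omega>[OF S(2), of v w u, folded d\<Omega>'_def] dskew[OF S(2), of v w u] skew[OF S(2), of u w] by simp
    moreover have "\<theta> x u * (d\<beta> x w v - d\<beta> x v w) = \<theta> x u * (\<theta> x w * \<beta> x v - \<theta> x v * \<beta> x w + f x * \<Omega> x v w)"
      "\<theta> x v * (d\<beta> x u w - d\<beta> x w u) = \<theta> x v * (\<theta> x u * \<beta> x w - \<theta> x w * \<beta> x u + f x * \<Omega> x w u)"
      "\<theta> x w * (d\<beta> x v u - d\<beta> x u v) = \<theta> x w * (\<theta> x v * \<beta> x u - \<theta> x u * \<beta> x v + f x * \<Omega> x u v)"
      using E[OF S(2)] skew[OF S(2), of v w] skew[OF S(2), of w u] skew[OF S(2), of u v] by simp_all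
    ultimately show ?thesis unfolding dE distrib_left right_diff_distrib mult.left_commute by linarith
  qed
  have "df u = 0" for u
    using wedge_nondegenerate_eq_0[OF dim \<Omega>(1,2)[OF S(2)] \<Omega>(4) _ wedge]
      has_derivative_linear[OF f'] by blast
  then have "df = (\<lambda>u. 0)" by auto
  then show ?thesis using f' by (simp add: f_def[abs_def])
qed

subsection \<open>Charts and primitives\<close>

lemma Ck_on_cong:
  fixes f g :: "'e::real_normed_vector \<Rightarrow> 'f::real_normed_vector"
  assumes "open S" "\<And>x. x \<in> S \<Longrightarrow> f x = g x"
  shows "Ck_on k S f \<longleftrightarrow> Ck_on k S g"
  using assms(2)
proof (induction k arbitrary: f g)
  case 0
  then show ?case using continuous_on_cong[OF refl] by auto
next
  case (Suc k)
  have imp: "Ck_on (Suc k) S q" if "Ck_on (Suc k) S p" "\<And>x. x \<in> S \<Longrightarrow> p x = q x" for p q :: "'e \<Rightarrow> 'f"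
  proof -
    have p: "(p has_derivative frechet_derivative p (at x)) (at x)" if "x \<in> S" for x
      using \<open>Ck_on (Suc k) S p\<close> that by (simp flip: frechet_derivative_works)
    then have q: "(q has_derivative frechet_derivative p (at x)) (at x)" if "x \<in> S" for x
      using has_derivative_transform_within_open[OF _ assms(1)] \<open>\<And>x. x \<in> S \<Longrightarrow> p x = q x\<close> that by metis
    then have "frechet_derivative p (at x) = frechet_derivative q (at x)" if "x \<in> S" for x
      using that frechet_derivative_at by blast
    then have "Ck_on k S (\<lambda>x. frechet_derivative q (at x) v)" for v
      using Suc.IH[of "\<lambda>x. frechet_derivative p (at x) v" "\<lambda>x. frechet_derivative q (at x) v"] that(1) by simp
    then show ?thesis using q by (auto intro: differentiableI)
  qed
  show ?case using imp[of f g, OF _ Suc.prems] imp[of g f, OF _ Suc.prems[symmetric]] by blast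
qed

lemma Ck_on_subset:
  assumes "Ck_on k S f" "T \<subseteq> S"
  shows "Ck_on k T f"
  using assms by (induction k arbitrary: f) (auto intro: continuous_on_subset)

lemma smooth_on_subset: "smooth_on S f \<Longrightarrow> T \<subseteq> S \<Longrightarrow> smooth_on T f"
  unfolding smooth_on_def using Ck_on_subset by blast

text \<open>On an open set \<open>frechet_derivative f\<close> agrees with \<open>f'\<close>, so
  smooth coefficients of the derivative give every order for \<open>f\<close>. A differentiable
  primitive of a smooth form is therefore smooth.\<close>

lemma smooth_on_if_derivative_smooth:
  assumes "open S" "\<And>x. x \<in> S \<Longrightarrow> (f has_derivative f' x) (at x)" "\<And>v. smooth_on S (\<lambda>x. f' x v)"
  shows "smooth_on S f"
  unfolding smooth_on_def
proof
  fix k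
  have eq: "frechet_derivative f (at x) = f' x" if "x \<in> S" for x
    using frechet_derivative_at[OF assms(2)[OF that]] by simp
  show "Ck_on k S f"
  proof (cases k)
    case 0
    then show ?thesis using assms(2)
      by (auto intro!: continuous_at_imp_continuous_on has_derivative_continuous)
  next
    case (Suc j)
    have "Ck_on j S (\<lambda>x. frechet_derivative f (at x) v)" for v
      using assms(3)[of v] Ck_on_cong[OF assms(1), of "\<lambda>x. frechet_derivative f (at x) v" "\<lambda>x. f' x v" j] eq
      by (simp add: smooth_on_def)
    then show ?thesis using Suc assms(2) by (auto intro: differentiableI)
  qed
qed

section \<open>Elementary properties of charts\<close>

lemma smooth_manifold_is_chart: "smooth_manifold M A \<Longrightarrow> c \<in> A \<Longrightarrow> is_chart M c"
  by (simp add: smooth_manifold_def)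

lemma chart_at_point:
  assumes "smooth_manifold M A" "p \<in> topspace M"
  obtains c where "c \<in> A" "p \<in> fst c"
proof -
  have "topspace M = (\<Union>c\<in>A. fst c)" using assms by (simp add: smooth_manifold_def)
  then show thesis using assms(2) that by blast
qed

lemma is_chartD:
  assumes "is_chart M c"
  shows chart_openin: "openin M (fst c)"
    and chart_open_image: "open (snd c ` fst c)"
    and chart_inj: "inj_on (snd c) (fst c)"
    and chart_continuous: "continuous_map (subtopology M (fst c)) euclidean (snd c)"
    and chart_inv_continuous: "continuous_map (top_of_set (snd c ` fst c)) M (chart_inv c)"
    and chart_open_image_Int: "openin M W \<Longrightarrow> open (snd c ` (fst c \<inter> W))"
    and chart_openin_vimage: "open B \<Longrightarrow> openin M {x \<in> fst c. snd c x \<in> B}"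
proof -
  have h: "homeomorphic_map (subtopology M (fst c)) (top_of_set (snd c ` fst c)) (snd c)"
    and o: "openin M (fst c)" "open (snd c ` fst c)"
    using assms by (auto simp: is_chart_def)
  have t: "topspace (subtopology M (fst c)) = fst c"
    using o(1) openin_subset by (auto simp: topspace_subtopology)
  show "openin M (fst c)" "open (snd c ` fst c)" by fact+
  show inj: "inj_on (snd c) (fst c)" using homeomorphic_imp_injective_map[OF h] t by simp
  show c: "continuous_map (subtopology M (fst c)) euclidean (snd c)"
    using homeomorphic_imp_continuous_map[OF h] by (simp add: continuous_map_in_subtopology)
  obtain g where g: "homeomorphic_maps (subtopology M (fst c)) (top_of_set (snd c ` fst c)) (snd c) g"
    using h homeomorphic_map_maps by blast
  \<comment> \<open>The continuous inverse supplied by the homeomorphism coincides with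
    \<open>chart_inv\<close> on the image, which transfers its continuity.\<close>
  have "g y = chart_inv c y" if y: "y \<in> snd c ` fst c" for y
    using g y inj unfolding chart_inv_def homeomorphic_maps_def t
    by (auto simp: topspace_subtopology)
  then have "continuous_map (top_of_set (snd c ` fst c)) (subtopology M (fst c)) (chart_inv c)"
    using g unfolding homeomorphic_maps_def by (auto elim!: continuous_map_eq)
  then show "continuous_map (top_of_set (snd c ` fst c)) M (chart_inv c)"
    by (simp add: continuous_map_in_subtopology)
  show "open (snd c ` (fst c \<inter> W))" if "openin M W"
  proof -
    have "openin (subtopology M (fst c)) (fst c \<inter> W)"
      using that by (simp add: Int_commute openin_subtopology_Int)
    then have "openin (top_of_set (snd c ` fst c)) (snd c ` (fst c \<inter> W))"
      using h homeomorphic_imp_open_map open_map_def by blast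
    then show ?thesis using o(2) openin_open_trans by blast
  qed
  show "openin M {x \<in> fst c. snd c x \<in> B}" if "open B"
  proof -
    have "openin (subtopology M (fst c)) {x \<in> topspace (subtopology M (fst c)). snd c x \<in> B}"
      by (rule openin_continuous_map_preimage[OF c]) (use that in simp)
    then show ?thesis using o(1) openin_trans_full t by fastforce
  qed
qed

lemma chart_inv_left [simp]: "is_chart M c \<Longrightarrow> x \<in> fst c \<Longrightarrow> chart_inv c (snd c x) = x"
  by (simp add: chart_inv_def chart_inj)

lemma chart_inv_right [simp]: "y \<in> snd c ` fst c \<Longrightarrow> snd c (chart_inv c y) = y"
  by (simp add: chart_inv_def f_inv_into_f)

lemma chart_inv_in: "y \<in> snd c ` fst c \<Longrightarrow> chart_inv c y \<in> fst c"
  by (simp add: chart_inv_def inv_into_into)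

text \<open>Smoothness of \<open>f\<close> is inherited from the coefficients of
  \<open>\<omega>\<close>, so only the first-order equation has to be verified for a candidate
  primitive.\<close>

lemma primitive_on_iff:
  assumes M: "smooth_manifold M A" and \<omega>: "one_form A \<omega>" and U: "openin M U"
  shows "primitive_on A \<omega> U f \<longleftrightarrow>
    (\<forall>c\<in>A. \<forall>x\<in>snd c ` (fst c \<inter> U). ((f \<circ> chart_inv c) has_derivative \<omega> c x) (at x))"
    (is "?L \<longleftrightarrow> ?R")
proof
  assume L: ?L
  show ?R
  proof (intro ballI)
    fix c x assume c: "c \<in> A" and x: "x \<in> snd c ` (fst c \<inter> U)"
    have "smooth_on (snd c ` (fst c \<inter> U)) (f \<circ> chart_inv c)"
      using L c by (auto simp: primitive_on_def smooth_function_def)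
    from smooth_on_has_derivative[OF this x]
    show "((f \<circ> chart_inv c) has_derivative \<omega> c x) (at x)"
      using L c x by (metis (no_types, lifting) d0_def ext primitive_on_def)
  qed
next
  assume R: ?R
  have "smooth_on (snd c ` (fst c \<inter> U)) (f \<circ> chart_inv c)" if c: "c \<in> A" for c
  proof (rule smooth_on_if_derivative_smooth[where f' = "\<omega> c"])
    show "open (snd c ` (fst c \<inter> U))"
      using chart_open_image_Int[OF smooth_manifold_is_chart[OF M c] U] .
    show "smooth_on (snd c ` (fst c \<inter> U)) (\<lambda>x. \<omega> c x v)" for v
      using \<omega> c by (auto simp: one_form_def intro: smooth_on_subset)
  qed (use R c in blast)
  moreover have "\<omega> c x v = d0 f c x v" if "c \<in> A" "x \<in> snd c ` (fst c \<inter> U)" for c x v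
    using frechet_derivative_at[of "f \<circ> chart_inv c" "\<omega> c x" x] R that by (simp add: d0_def)
  ultimately show ?L by (auto simp: primitive_on_def smooth_function_def)
qed

lemma transition_has_derivative:
  assumes M: "smooth_manifold M A" and cd: "c \<in> A" "d \<in> A" "x \<in> snd c ` (fst c \<inter> fst d)"
  shows "(transition c d has_derivative frechet_derivative (transition c d) (at x)) (at x)"
  using smooth_on_has_derivative[of "snd c ` (fst c \<inter> fst d)" "transition c d" x] M cd by (auto simp: smooth_manifold_def)

text \<open>By the chain rule and the transformation law of \<open>\<omega>\<close>, the equation in
  one chart containing \<open>U\<close> implies it in every other chart meeting
  \<open>U\<close>.\<close>

lemma primitive_on_chartI:
  assumes M: "smooth_manifold M A" and \<omega>: "one_form A \<omega>" and U: "openin M U"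
    and c: "c \<in> A" "U \<subseteq> fst c"
    and f: "\<And>x. x \<in> snd c ` U \<Longrightarrow> ((f \<circ> chart_inv c) has_derivative \<omega> c x) (at x)"
  shows "primitive_on A \<omega> U f"
  unfolding primitive_on_iff[OF M \<omega> U]
proof (intro ballI)
  fix d x assume d: "d \<in> A" and x: "x \<in> snd d ` (fst d \<inter> U)"
  note chc = smooth_manifold_is_chart[OF M c(1)] and chd = smooth_manifold_is_chart[OF M d]
  have x': "x \<in> snd d ` (fst d \<inter> fst c)" using x c by auto
  have tr: "transition d c x \<in> snd c ` U"
    using x chd by (auto simp: transition_def)
  have "((\<lambda>y. (f \<circ> chart_inv c) (transition d c y)) has_derivative
      (\<lambda>v. \<omega> c (transition d c x) (frechet_derivative (transition d c) (at x) v))) (at x)"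
    by (rule has_derivative_compose[OF transition_has_derivative[OF M d c(1) x'] f[OF tr]])
  also have "(\<lambda>v. \<omega> c (transition d c x) (frechet_derivative (transition d c) (at x) v)) = \<omega> d x"
    using \<omega> d c(1) x' unfolding one_form_def by (intro ext) metis
  finally show "((f \<circ> chart_inv d) has_derivative \<omega> d x) (at x)"
    by (rule has_derivative_transform_within_open[OF _ chart_open_image_Int[OF chd U] x])
       (use c chc chd in \<open>auto simp: transition_def\<close>)
qed

lemma primitive_on_ball:
  assumes M: "smooth_manifold M A" and \<omega>: "closed_one_form A \<omega>"
    and c: "c \<in> A" "ball a e \<subseteq> snd c ` fst c" and e: "e > 0"
  obtains f where "primitive_on A \<omega> {x \<in> fst c. snd c x \<in> ball a e} f"
proof -
  note chc = smooth_manifold_is_chart[OF M c(1)]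
  have of: "one_form A \<omega>" using \<omega> by (simp add: closed_one_form_def)
  define w' where "w' y u v = frechet_derivative (\<lambda>z. \<omega> c z v) (at y) u" for y u v
  define g where "g y = integral {0..1} (\<lambda>t. \<omega> c (a + t *\<^sub>R (y - a)) (y - a))" for y
  have sm: "smooth_on (snd c ` fst c) (\<lambda>y. \<omega> c y v)" for v using of c by (simp add: one_form_def)
  have g: "(g has_derivative \<omega> c x) (at x)" if "x \<in> ball a e" for x
    unfolding g_def
  proof (rule has_derivative_segment_integral[OF open_ball convex_ball _ that])
    show "a \<in> ball a e" using e by simp
    show "linear (\<omega> c y)" if "y \<in> ball a e" for y
      using of c that by (auto simp: one_form_def)
    show "((\<lambda>z. \<omega> c z v) has_derivative (\<lambda>u. w' y u v)) (at y)" if "y \<in> ball a e" for y v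
      using smooth_on_has_derivative[OF sm, of y v] c that unfolding w'_def by auto
    show "continuous_on (ball a e) (\<lambda>y. w' y u v)" for u v
      unfolding w'_def
      by (rule continuous_on_subset[OF smooth_on_continuous[OF smooth_on_frechet_derivative[OF sm]] c(2)])
    show "w' y u v = w' y v u" if "y \<in> ball a e" for y u v
    proof -
      have "y \<in> snd c ` fst c" using c that by blast
      then have "d1 \<omega> c y u v = 0" using \<omega> c(1) unfolding closed_one_form_def by blast
      then show ?thesis by (simp add: d1_def w'_def)
    qed
  qed
  let ?U = "{x \<in> fst c. snd c x \<in> ball a e}"
  have "primitive_on A \<omega> ?U (g \<circ> snd c)"
  proof (rule primitive_on_chartI[OF M of _ c(1)])
    show "openin M ?U" by (rule chart_openin_vimage[OF chc]) simp
    fix x assume "x \<in> snd c ` ?U"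
    then have x: "x \<in> ball a e" by auto
    show "(g \<circ> snd c \<circ> chart_inv c has_derivative \<omega> c x) (at x)"
      by (rule has_derivative_transform_within_open[OF g[OF x] open_ball x]) (use c in auto)
  qed auto
  then show thesis by (rule that)
qed

lemma primitive_at_point:
  assumes M: "smooth_manifold M A" and \<omega>: "closed_one_form A \<omega>" and p: "p \<in> topspace M"
  obtains U f where "openin M U" "p \<in> U" "primitive_on A \<omega> U f"
proof -
  obtain c where c: "c \<in> A" "p \<in> fst c" using chart_at_point[OF M p] .
  note chc = smooth_manifold_is_chart[OF M c(1)]
  obtain e where e: "e > 0" "ball (snd c p) e \<subseteq> snd c ` fst c"
    using chart_open_image[OF chc] c(2) by (meson imageI open_contains_ball)
  obtain f where "primitive_on A \<omega> {x \<in> fst c. snd c x \<in> ball (snd c p) e} f"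
    using primitive_on_ball[OF M \<omega> c(1) e(2,1)] .
  moreover have "openin M {x \<in> fst c. snd c x \<in> ball (snd c p) e}"
    by (rule chart_openin_vimage[OF chc]) simp
  ultimately show thesis using that c e by auto
qed

text \<open>In a chart the difference of the two functions has derivative zero on a ball, hence is
  constant there. Increments along a path are thus locally independent of the primitive
  chosen.\<close>

lemma primitives_differ_locally_constant:
  assumes M: "smooth_manifold M A" and \<omega>: "one_form A \<omega>"
    and f: "openin M U" "primitive_on A \<omega> U f" and g: "openin M V" "primitive_on A \<omega> V g"
    and p: "p \<in> U" "p \<in> V"
  obtains W where "openin M W" "p \<in> W" "\<And>x. x \<in> W \<Longrightarrow> f x - f p = g x - g p"
proof -
  have "p \<in> topspace M" using f p openin_subset by blast
  then obtain c where c: "c \<in> A" "p \<in> fst c" using chart_at_point[OF M] by blast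
  note chc = smooth_manifold_is_chart[OF M c(1)]
  have "open (snd c ` (fst c \<inter> (U \<inter> V)))"
    using chart_open_image_Int[OF chc] f g by blast
  moreover have "snd c p \<in> snd c ` (fst c \<inter> (U \<inter> V))" using c p by blast
  ultimately obtain e where e: "e > 0" "ball (snd c p) e \<subseteq> snd c ` (fst c \<inter> (U \<inter> V))"
    by (rule openE)
  let ?B = "ball (snd c p) e"
  have d: "(f \<circ> chart_inv c has_derivative \<omega> c y) (at y)" "(g \<circ> chart_inv c has_derivative \<omega> c y) (at y)"
    if "y \<in> ?B" for y
  proof -
    have "y \<in> snd c ` (fst c \<inter> U)" "y \<in> snd c ` (fst c \<inter> V)" using e that by auto
    then show "(f \<circ> chart_inv c has_derivative \<omega> c y) (at y)" "(g \<circ> chart_inv c has_derivative \<omega> c y) (at y)"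
      using f g c(1) primitive_on_iff[OF M \<omega>] by blast+
  qed
  have "((\<lambda>y. (f \<circ> chart_inv c) y - (g \<circ> chart_inv c) y) has_derivative (\<lambda>h. 0)) (at y within ?B)"
    if "y \<in> ?B" for y
    using has_derivative_diff[OF d[OF that]] by (simp add: has_derivative_at_withinI)
  from has_derivative_zero_constant[OF convex_ball this]
  obtain k where k: "\<And>y. y \<in> ?B \<Longrightarrow> (f \<circ> chart_inv c) y - (g \<circ> chart_inv c) y = k" by blast
  have k': "f x - g x = k" if "x \<in> fst c" "snd c x \<in> ?B" for x
    using k[OF that(2)] that chc by simp
  show thesis
  proof (rule that)
    show "openin M {x \<in> fst c. snd c x \<in> ?B}"
      by (rule chart_openin_vimage[OF chc]) simp
    show "p \<in> {x \<in> fst c. snd c x \<in> ?B}" using c e by simp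
    show "f x - f p = g x - g p" if "x \<in> {x \<in> fst c. snd c x \<in> ?B}" for x
      using k'[of x] k'[of p] that c e by simp
  qed
qed

subsection \<open>Integrals along paths\<close>

text \<open>A function of time that records the integral accumulated along \<open>\<gamma>\<close>.
  Testing it against every local primitive, rather than those of one subdivision, makes functions
  obtained from different subdivisions directly comparable.\<close>

definition antiderivative_along ::
  "'a topology \<Rightarrow> ('a, 'e::euclidean_space) chart set \<Rightarrow> ('a, 'e) form1 \<Rightarrow> (real \<Rightarrow> 'a) \<Rightarrow> real set \<Rightarrow> (real \<Rightarrow> real) \<Rightarrow> bool"
where
  "antiderivative_along M A \<omega> \<gamma> S F \<longleftrightarrow>
     (\<forall>s\<in>S. \<forall>U f. openin M U \<longrightarrow> \<gamma> s \<in> U \<longrightarrow> primitive_on A \<omega> U f \<longrightarrow>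
        (\<forall>\<^sub>F r in at s within S. F r - F s = f (\<gamma> r) - f (\<gamma> s)))"

lemma pathin_eventually:
  assumes "pathin M \<gamma>" "openin M W" "s \<in> {0..1}" "\<gamma> s \<in> W"
  shows "\<forall>\<^sub>F r in at s within {0..1}. \<gamma> r \<in> W"
proof -
  have "openin (top_of_set {0..1}) {r \<in> topspace (top_of_set {0..1}). \<gamma> r \<in> W}"
    by (rule openin_continuous_map_preimage) (use assms in \<open>auto simp: pathin_def\<close>)
  then obtain T where T: "open T" "{r \<in> {0..1}. \<gamma> r \<in> W} = {0..1} \<inter> T"
    by (auto simp: openin_open)
  have "s \<in> T" using T assms by blast
  then show ?thesis unfolding eventually_at_topological
    using T by blast
qed

text \<open>Only the time \<open>s = a\<close> involves both halves of \<open>{0..b}\<close>;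
  elsewhere one of the two filters is trivial. On the new half, \<open>f\<close> and the test
  primitive \<open>g\<close> have the same increments near \<open>\<gamma> s\<close>.\<close>

lemma antiderivative_along_extend:
  assumes M: "smooth_manifold M A" and \<omega>: "one_form A \<omega>" and \<gamma>: "pathin M \<gamma>"
    and ab: "0 \<le> a" "a \<le> b" "b \<le> 1"
    and F: "antiderivative_along M A \<omega> \<gamma> {0..a} F"
    and U: "openin M U" "primitive_on A \<omega> U f" "\<gamma> ` {a..b} \<subseteq> U"
  shows "antiderivative_along M A \<omega> \<gamma> {0..b} (\<lambda>r. if r \<le> a then F r else F a + (f (\<gamma> r) - f (\<gamma> a)))"
    (is "antiderivative_along _ _ _ _ _ ?F")
  unfolding antiderivative_along_def
proof (intro ballI allI impI)
  fix s V g assume s: "s \<in> {0..b}" and V: "openin M V" "\<gamma> s \<in> V" "primitive_on A \<omega> V g"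
  have "\<forall>\<^sub>F r in at s within {0..a}. ?F r - ?F s = g (\<gamma> r) - g (\<gamma> s)"
  proof (cases "s \<le> a")
    case True
    then have "\<forall>\<^sub>F r in at s within {0..a}. F r - F s = g (\<gamma> r) - g (\<gamma> s)"
      using F V s unfolding antiderivative_along_def by simp
    moreover have "\<forall>\<^sub>F r in at s within {0..a}. r \<in> {0..a}"
      by (auto simp: eventually_at_filter)
    ultimately show ?thesis by eventually_elim (use True in simp)
  next
    case False
    have "\<forall>\<^sub>F r in at s within {0..a}. False"
      unfolding eventually_at using False by (intro exI[of _ "s - a"]) (auto simp: dist_real_def)
    then show ?thesis by (rule eventually_mono) simp
  qed
  moreover have "\<forall>\<^sub>F r in at s within {a..b}. ?F r - ?F s = g (\<gamma> r) - g (\<gamma> s)"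
  proof (cases "a \<le> s")
    case True
    then have sU: "\<gamma> s \<in> U" using U s by auto
    obtain W where W: "openin M W" "\<gamma> s \<in> W" "\<And>x. x \<in> W \<Longrightarrow> f x - f (\<gamma> s) = g x - g (\<gamma> s)"
      by (rule primitives_differ_locally_constant[OF M \<omega> U(1,2) V(1,3) sU V(2)]) blast
    have "\<forall>\<^sub>F r in at s within {0..1}. \<gamma> r \<in> W"
      using pathin_eventually[OF \<gamma> W(1) _ W(2)] s ab by simp
    then have "\<forall>\<^sub>F r in at s within {a..b}. \<gamma> r \<in> W"
      by (rule filter_leD[OF at_le, rotated]) (use ab in auto)
    moreover have "\<forall>\<^sub>F r in at s within {a..b}. r \<in> {a..b}"
      by (auto simp: eventually_at_filter)
    ultimately show ?thesis
    proof eventually_elim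
      case (elim r)
      \<comment> \<open>The formula of the second branch is valid at \<open>q = a\<close> too, since
        the branches agree there.\<close>
      have *: "?F q = F a + (f (\<gamma> q) - f (\<gamma> a))" if "a \<le> q" for q using that by auto
      have "a \<le> r" using elim by simp
      from W(3)[OF elim(1)] show ?case unfolding *[OF True] *[OF \<open>a \<le> r\<close>] by simp
    qed
  next
    case False
    have "\<forall>\<^sub>F r in at s within {a..b}. False"
      unfolding eventually_at using False by (intro exI[of _ "a - s"]) (auto simp: dist_real_def)
    then show ?thesis by (rule eventually_mono) simp
  qed
  moreover have "{0..b} = {0..a} \<union> {a..b}" using ab by auto
  ultimately show "\<forall>\<^sub>F r in at s within {0..b}. ?F r - ?F s = g (\<gamma> r) - g (\<gamma> s)"
    by (simp only: at_within_union eventually_sup)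
qed

lemma has_form_integral_antiderivative:
  assumes M: "smooth_manifold M A" and \<omega>: "one_form A \<omega>" and \<gamma>: "pathin M \<gamma>"
    and I: "has_form_integral M A \<omega> \<gamma> I"
  obtains F where "antiderivative_along M A \<omega> \<gamma> {0..1} F" "F 1 - F 0 = I"
proof -
  obtain m :: nat and t U f where t: "t 0 = 0" "t m = 1"
    and piece: "\<And>i. i < m \<Longrightarrow> t i < t (Suc i) \<and> openin M (U i) \<and> \<gamma> ` {t i..t (Suc i)} \<subseteq> U i \<and>
               primitive_on A \<omega> (U i) (f i)"
    and I: "I = (\<Sum>i<m. f i (\<gamma> (t (Suc i))) - f i (\<gamma> (t i)))"
    using I unfolding has_form_integral_def by blast
  have ti: "t i \<le> 1" if "i \<le> m" for i
    using that t(2) by (induction rule: inc_induct) (use piece in force)+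
  have "0 \<le> t i \<and> (\<exists>F. antiderivative_along M A \<omega> \<gamma> {0..t i} F \<and>
      F (t i) - F 0 = (\<Sum>j<i. f j (\<gamma> (t (Suc j))) - f j (\<gamma> (t j))))" if "i \<le> m" for i
    using that
  proof (induction i)
    case 0
    \<comment> \<open>On the degenerate interval the punctured filter at \<open>0\<close> is
      trivial, so every function qualifies.\<close>
    show ?case using t(1) by (auto simp: antiderivative_along_def eventually_at_filter)
  next
    case (Suc i)
    then obtain F where F: "0 \<le> t i" "antiderivative_along M A \<omega> \<gamma> {0..t i} F"
      "F (t i) - F 0 = (\<Sum>j<i. f j (\<gamma> (t (Suc j))) - f j (\<gamma> (t j)))" by auto
    have p: "t i < t (Suc i)" "openin M (U i)" "\<gamma> ` {t i..t (Suc i)} \<subseteq> U i" "primitive_on A \<omega> (U i) (f i)"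
      using piece Suc.prems by auto
    have "antiderivative_along M A \<omega> \<gamma> {0..t (Suc i)}
        (\<lambda>r. if r \<le> t i then F r else F (t i) + (f i (\<gamma> r) - f i (\<gamma> (t i))))"
      by (rule antiderivative_along_extend[OF M \<omega> \<gamma> F(1) _ ti F(2) p(2,4,3)]) (use p Suc in auto)
    then show ?case using F p
      by (intro conjI exI[of _ "\<lambda>r. if r \<le> t i then F r else F (t i) + (f i (\<gamma> r) - f i (\<gamma> (t i)))"]) auto
  qed
  from this[of m] t I show thesis using that by auto
qed

text \<open>The antiderivatives belonging to two values of the integral differ by a locally constant
  function, as both follow one primitive near each time; closedness of \<open>\<omega>\<close>
  supplies that primitive. Connectedness of \<open>{0..1}\<close> makes the difference constant,
  without a common refinement of the two subdivisions.\<close>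

lemma form_integral_eq:
  assumes M: "smooth_manifold M A" and \<omega>: "closed_one_form A \<omega>" and \<gamma>: "pathin M \<gamma>"
    and I: "has_form_integral M A \<omega> \<gamma> I"
  shows "form_integral M A \<omega> \<gamma> = I"
  unfolding form_integral_def
proof (rule the_equality)
  show "has_form_integral M A \<omega> \<gamma> I" by fact
next
  fix J assume J: "has_form_integral M A \<omega> \<gamma> J"
  have of: "one_form A \<omega>" using \<omega> by (simp add: closed_one_form_def)
  obtain F where F: "antiderivative_along M A \<omega> \<gamma> {0..1} F" "F 1 - F 0 = I"
    using has_form_integral_antiderivative[OF M of \<gamma> I] .
  obtain G where G: "antiderivative_along M A \<omega> \<gamma> {0..1} G" "G 1 - G 0 = J"
    using has_form_integral_antiderivative[OF M of \<gamma> J] .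
  have "F 0 - G 0 = F 1 - G 1"
  proof (rule connected_local_const[where A = "{0..1}" and f = "\<lambda>r. F r - G r" and a = 0 and b = 1])
    show "\<forall>s\<in>{0..1}. \<forall>\<^sub>F r in at s within {0..1}. F s - G s = F r - G r"
    proof
      fix s :: real assume s: "s \<in> {0..1}"
      then have "\<gamma> s \<in> topspace M" using \<gamma> by (auto simp: pathin_def continuous_map_def)
      then obtain U f where U: "openin M U" "\<gamma> s \<in> U" "primitive_on A \<omega> U f"
        using primitive_at_point[OF M \<omega>] by blast
      have "\<forall>\<^sub>F r in at s within {0..1}. F r - F s = f (\<gamma> r) - f (\<gamma> s)"
        "\<forall>\<^sub>F r in at s within {0..1}. G r - G s = f (\<gamma> r) - f (\<gamma> s)"
        using F(1) G(1) U s unfolding antiderivative_along_def by blast+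
      then show "\<forall>\<^sub>F r in at s within {0..1}. F s - G s = F r - G r"
        by eventually_elim simp
    qed
  qed auto
  then show "J = I" using F G by simp
qed

section \<open>Path integrals: a single piece, concatenation, exact terms\<close>

lemma has_form_integral_within_primitive:
  assumes "openin M U" "primitive_on A \<omega> U f" "\<gamma> ` {0..1} \<subseteq> U"
  shows "has_form_integral M A \<omega> \<gamma> (f (\<gamma> 1) - f (\<gamma> 0))"
  unfolding has_form_integral_def
  \<comment> \<open>With one piece, \<open>real\<close> itself is the subdivision: its nodes are
    \<open>0\<close> and \<open>1\<close>.\<close>
  by (rule exI[of _ 1], rule exI[of _ real], rule exI[of _ "\<lambda>_. U"], rule exI[of _ "\<lambda>_. f"])
     (use assms in auto)

lemma has_form_integral_join:
  assumes \<gamma>: "has_form_integral M A \<omega> \<gamma> I" and \<delta>: "has_form_integral M A \<omega> \<delta> J"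
    and eq: "\<gamma> 1 = \<delta> 0"
  shows "has_form_integral M A \<omega> (\<lambda>r. if r \<le> 1 / 2 then \<gamma> (2 * r) else \<delta> (2 * r - 1)) (I + J)"
    (is "has_form_integral _ _ _ ?j _")
proof -
  define j where "j = ?j"
  obtain m :: nat and t U f where t: "t 0 = 0" "t m = 1"
    and p: "\<And>i. i < m \<Longrightarrow> t i < t (Suc i) \<and> openin M (U i) \<and> \<gamma> ` {t i..t (Suc i)} \<subseteq> U i \<and>
               primitive_on A \<omega> (U i) (f i)"
    and I: "I = (\<Sum>i<m. f i (\<gamma> (t (Suc i))) - f i (\<gamma> (t i)))"
    using \<gamma> unfolding has_form_integral_def by blast
  obtain n :: nat and u V g where u: "u 0 = 0" "u n = 1"
    and q: "\<And>i. i < n \<Longrightarrow> u i < u (Suc i) \<and> openin M (V i) \<and> \<delta> ` {u i..u (Suc i)} \<subseteq> V i \<and>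
               primitive_on A \<omega> (V i) (g i)"
    and J: "J = (\<Sum>i<n. g i (\<delta> (u (Suc i))) - g i (\<delta> (u i)))"
    using \<delta> unfolding has_form_integral_def by blast
  have t1: "t i \<le> 1" if "i \<le> m" for i
    using that t(2) by (induction rule: inc_induct) (use p in force)+
  have u0: "0 \<le> u i" if "i \<le> n" for i
    using that
  proof (induction i)
    case (Suc i)
    then show ?case using q[of i] by simp
  qed (simp add: u)
  \<comment> \<open>There are \<open>m + n\<close> pieces but one more node, and node
    \<open>m\<close> is shared by both halves: hence \<open>i \<le> m\<close> here and
    \<open>i < m\<close> for \<open>W\<close> and \<open>h\<close>.\<close>
  define v where "v i = (if i \<le> m then t i / 2 else 1 / 2 + u (i - m) / 2)" for i
  define W where "W i = (if i < m then U i else V (i - m))" for i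
  define h where "h i = (if i < m then f i else g (i - m))" for i
  have v2: "v (m + i) = 1 / 2 + u i / 2" for i using t u by (auto simp: v_def)
  have j1: "j r = \<gamma> (2 * r)" if "r \<le> 1 / 2" for r using that by (simp add: j_def)
  \<comment> \<open>The closed pieces of the second half contain the joint, so its formula must hold
    at \<open>1 / 2\<close> as well; \<open>eq\<close> gives this.\<close>
  have j2: "j r = \<delta> (2 * r - 1)" if "1 / 2 \<le> r" for r
  proof (cases "r = 1 / 2")
    case True
    then show ?thesis using eq by (simp only: j_def) simp
  qed (use that in \<open>auto simp: j_def\<close>)
  have step1: "v i < v (Suc i) \<and> openin M (W i) \<and> j ` {v i..v (Suc i)} \<subseteq> W i \<and>
      primitive_on A \<omega> (W i) (h i) \<and>
      h i (j (v (Suc i))) - h i (j (v i)) = f i (\<gamma> (t (Suc i))) - f i (\<gamma> (t i))"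
    if i: "i < m" for i
  proof -
    have v: "v i = t i / 2" "v (Suc i) = t (Suc i) / 2" using i by (auto simp: v_def)
    have le: "t (Suc i) \<le> 1" using t1 i by simp
    have "j r \<in> U i" if "r \<in> {v i..v (Suc i)}" for r
    proof -
      have "2 * r \<in> {t i..t (Suc i)}" "r \<le> 1 / 2" using that v le by auto
      then show ?thesis using p[OF i] j1 by auto
    qed
    moreover have "j (v i) = \<gamma> (t i)" "j (v (Suc i)) = \<gamma> (t (Suc i))"
      unfolding v using j1[of "t i / 2"] j1[of "t (Suc i) / 2"] p[OF i] le by auto
    ultimately show ?thesis unfolding v W_def h_def using p[OF i] i by auto
  qed
  have step2: "v (m + i) < v (Suc (m + i)) \<and> openin M (W (m + i)) \<and>
      j ` {v (m + i)..v (Suc (m + i))} \<subseteq> W (m + i) \<and> primitive_on A \<omega> (W (m + i)) (h (m + i)) \<and>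
      h (m + i) (j (v (Suc (m + i)))) - h (m + i) (j (v (m + i)))
        = g i (\<delta> (u (Suc i))) - g i (\<delta> (u i))"
    if i: "i < n" for i
  proof -
    have v: "v (m + i) = 1 / 2 + u i / 2" "v (Suc (m + i)) = 1 / 2 + u (Suc i) / 2"
      using v2[of i] v2[of "Suc i"] by auto
    have le: "0 \<le> u i" using u0 i by simp
    have "j r \<in> V i" if "r \<in> {v (m + i)..v (Suc (m + i))}" for r
    proof -
      have "2 * r - 1 \<in> {u i..u (Suc i)}" "1 / 2 \<le> r" using that v le by auto
      then show ?thesis using q[OF i] j2 by auto
    qed
    moreover have "j (v (m + i)) = \<delta> (u i)" "j (v (Suc (m + i))) = \<delta> (u (Suc i))"
      unfolding v using j2[of "1 / 2 + u i / 2"] j2[of "1 / 2 + u (Suc i) / 2"] q[OF i] le by auto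
    ultimately show ?thesis unfolding v W_def h_def using q[OF i] i by auto
  qed
  have "v i < v (Suc i) \<and> openin M (W i) \<and> j ` {v i..v (Suc i)} \<subseteq> W i \<and>
      primitive_on A \<omega> (W i) (h i)" if "i < m + n" for i
    using step1[of i] step2[of "i - m"] that by (cases "i < m") auto
  moreover have "v 0 = 0" "v (m + n) = 1" using t v2[of n] u by (auto simp: v_def)
  moreover have "I + J = (\<Sum>i<m + n. h i (j (v (Suc i))) - h i (j (v i)))"
  proof -
    have "(\<Sum>i<m + n. h i (j (v (Suc i))) - h i (j (v i))) =
        (\<Sum>i<m. h i (j (v (Suc i))) - h i (j (v i))) +
        (\<Sum>i<n. h (m + i) (j (v (Suc (m + i)))) - h (m + i) (j (v (m + i))))"
      by (induction n) auto
    also have "\<dots> = I + J"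
      unfolding I J using step1 step2 by (intro arg_cong2[where f = "(+)"] sum.cong) auto
    finally show ?thesis by simp
  qed
  ultimately have "has_form_integral M A \<omega> j (I + J)" unfolding has_form_integral_def by blast
  then show ?thesis by (simp only: j_def)
qed

text \<open>One subdivision serves both forms, with \<open>f i + g\<close> in place of
  \<open>f i\<close>, and the increments of \<open>g\<close> telescope. The correction depends only
  on the end points, so on a compact space it stays bounded however long the path is.\<close>

lemma has_form_integral_add_exact:
  assumes M: "smooth_manifold M A" and \<omega>: "one_form A \<omega>" and \<eta>: "one_form A \<eta>"
    and g: "smooth_function A (topspace M) g"
    and eq: "\<And>c x v. c \<in> A \<Longrightarrow> x \<in> snd c ` fst c \<Longrightarrow> \<eta> c x v = \<omega> c x v + d0 g c x v"
    and I: "has_form_integral M A \<omega> \<gamma> I"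
  shows "has_form_integral M A \<eta> \<gamma> (I + (g (\<gamma> 1) - g (\<gamma> 0)))"
proof -
  obtain m :: nat and t U f where t: "t 0 = 0" "t m = 1"
    and p: "\<And>i. i < m \<Longrightarrow> t i < t (Suc i) \<and> openin M (U i) \<and> \<gamma> ` {t i..t (Suc i)} \<subseteq> U i \<and>
               primitive_on A \<omega> (U i) (f i)"
    and I: "I = (\<Sum>i<m. f i (\<gamma> (t (Suc i))) - f i (\<gamma> (t i)))"
    using I unfolding has_form_integral_def by blast
  have prim: "primitive_on A \<eta> V (\<lambda>x. k x + g x)" if V: "openin M V" and k: "primitive_on A \<omega> V k" for V k
    unfolding primitive_on_iff[OF M \<eta> V]
  proof (intro ballI)
    fix c x assume c: "c \<in> A" and x: "x \<in> snd c ` (fst c \<inter> V)"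
    have "fst c \<subseteq> topspace M"
      using smooth_manifold_is_chart[OF M c] chart_openin openin_subset by blast
    then have fc: "fst c \<inter> topspace M = fst c" by blast
    have x': "x \<in> snd c ` fst c" using x by blast
    have "smooth_on (snd c ` fst c) (g \<circ> chart_inv c)"
      using g c fc by (auto simp: smooth_function_def)
    from smooth_on_has_derivative[OF this x']
    have "(g \<circ> chart_inv c has_derivative (\<lambda>v. d0 g c x v)) (at x)" by (simp add: d0_def)
    moreover have "(k \<circ> chart_inv c has_derivative \<omega> c x) (at x)"
      using k c x primitive_on_iff[OF M \<omega> V] by blast
    ultimately have "((\<lambda>y. (k \<circ> chart_inv c) y + (g \<circ> chart_inv c) y) has_derivative
        (\<lambda>v. \<omega> c x v + d0 g c x v)) (at x)"
      by (rule has_derivative_add[rotated])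
    moreover have "(\<lambda>v. \<omega> c x v + d0 g c x v) = \<eta> c x"
      using eq[OF c x'] by auto
    ultimately show "((\<lambda>x. k x + g x) \<circ> chart_inv c has_derivative \<eta> c x) (at x)"
      by (simp add: o_def)
  qed
  have "I + (g (\<gamma> 1) - g (\<gamma> 0)) =
      (\<Sum>i<m. (f i (\<gamma> (t (Suc i))) + g (\<gamma> (t (Suc i)))) - (f i (\<gamma> (t i)) + g (\<gamma> (t i))))"
    using sum_lessThan_telescope[of "\<lambda>i. g (\<gamma> (t i))" m] t I by (simp add: sum.distrib sum_subtractf)
  then show ?thesis
    unfolding has_form_integral_def using t p prim
    by (intro exI[of _ m] exI[of _ t] exI[of _ U] exI[of _ "\<lambda>i x. f i x + g x"]) auto
qed

subsection \<open>Movements decreasing the integral\<close>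

text \<open>The condition \<open>\<psi> x = 0 \<Longrightarrow> h (1, x) = x\<close> makes strict decrease pass to compositions: a point
  that the earlier movement displaces has already lowered the integral strictly, so a composition
  is strict wherever one of its factors is.\<close>

definition movement ::
  "'a topology \<Rightarrow> ('a, 'e::euclidean_space) chart set \<Rightarrow> ('a, 'e) form1 \<Rightarrow> (real \<times> 'a \<Rightarrow> 'a) \<Rightarrow> ('a \<Rightarrow> real) \<Rightarrow> bool"
where
  "movement M A \<omega> h \<psi> \<longleftrightarrow>
     continuous_map (prod_topology (top_of_set {0..1}) M) M h \<and>
     continuous_map M euclideanreal \<psi> \<and>
     (\<forall>x\<in>topspace M. h (0, x) = x \<and> 0 \<le> \<psi> x \<and> (\<psi> x = 0 \<longrightarrow> h (1, x) = x) \<and>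
        (\<exists>I\<le>- \<psi> x. has_form_integral M A \<omega> (\<lambda>t. h (t, x)) I))"

lemma movementD:
  assumes "movement M A \<omega> h \<psi>"
  shows "continuous_map (prod_topology (top_of_set {0..1}) M) M h" "continuous_map M euclideanreal \<psi>"
    and "x \<in> topspace M \<Longrightarrow> h (0, x) = x" "x \<in> topspace M \<Longrightarrow> 0 \<le> \<psi> x"
    and "x \<in> topspace M \<Longrightarrow> \<psi> x = 0 \<Longrightarrow> h (1, x) = x"
    and "x \<in> topspace M \<Longrightarrow> \<exists>I\<le>- \<psi> x. has_form_integral M A \<omega> (\<lambda>t. h (t, x)) I"
  using assms by (auto simp: movement_def)

lemma continuous_map_homotopy_slice:
  assumes "continuous_map (prod_topology (top_of_set T) M) N h" "t \<in> T"
  shows "continuous_map M N (\<lambda>x. h (t, x))"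
proof -
  have "continuous_map M (prod_topology (top_of_set T) M) (\<lambda>x. (t, x))"
    using assms(2) by (auto simp: continuous_map_paired continuous_map_in_subtopology)
  from continuous_map_compose[OF this assms(1)] show ?thesis by (simp add: o_def)
qed

lemma pathin_homotopy:
  assumes "continuous_map (prod_topology (top_of_set {0..1}) M) N h" "x \<in> topspace M"
  shows "pathin N (\<lambda>t. h (t, x))"
proof -
  have "continuous_map (top_of_set {0..1}) (prod_topology (top_of_set {0..1}) M) (\<lambda>t. (t, x))"
    using assms(2) by (auto simp: continuous_map_paired)
  from continuous_map_compose[OF this assms(1)] show ?thesis by (simp add: o_def pathin_def)
qed

lemma movement_id:
  assumes M: "smooth_manifold M A" and \<omega>: "closed_one_form A \<omega>"
  shows "movement M A \<omega> snd (\<lambda>_. 0)"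
proof -
  have "has_form_integral M A \<omega> (\<lambda>t. x) 0" if x: "x \<in> topspace M" for x
  proof -
    obtain U f where U: "openin M U" "x \<in> U" "primitive_on A \<omega> U f"
      using primitive_at_point[OF M \<omega> x] .
    then have "(\<lambda>t. x) ` {0..1::real} \<subseteq> U" by auto
    from has_form_integral_within_primitive[OF U(1,3) this] show ?thesis by simp
  qed
  then show ?thesis unfolding movement_def by (auto intro!: continuous_map_snd exI[of _ 0])
qed

text \<open>The second movement starts at \<open>h (1, x)\<close>, which is why
  \<open>\<phi>\<close> is evaluated there. Both terms are nonnegative, so a zero sum makes both
  vanish; then \<open>h\<close> ends at \<open>x\<close>, and \<open>k\<close>, starting there, ends
  at \<open>x\<close> again.\<close>

lemma movement_compose:
  assumes h: "movement M A \<omega> h \<psi>" and k: "movement M A \<omega> k \<phi>"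
  obtains l where "movement M A \<omega> l (\<lambda>x. \<psi> x + \<phi> (h (1, x)))"
proof
  define l where "l p = (if fst p \<le> 1 / 2 then (h \<circ> (\<lambda>p. (2 * fst p, snd p))) p
      else (k \<circ> (\<lambda>p. (2 * fst p - 1, h (1, snd p)))) p)" for p
  note hD = movementD[OF h] and kD = movementD[OF k]
  let ?X = "prod_topology (top_of_set {0..1::real}) M"
  have h1: "continuous_map M M (\<lambda>x. h (1, x))"
    using continuous_map_homotopy_slice[OF hD(1)] by simp
  then have h1M: "h (1, x) \<in> topspace M" if "x \<in> topspace M" for x
    using that by (auto simp: continuous_map_def)
  have fst: "continuous_map ?X euclideanreal fst"
    using continuous_map_fst continuous_map_in_subtopology by blast
  have "continuous_map ?X M l"
    unfolding l_def
  proof (rule continuous_map_cases_le)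
    let ?Y = "subtopology ?X {p \<in> topspace ?X. fst p \<le> 1 / 2}"
    have "continuous_map ?Y (top_of_set {0..1}) (\<lambda>p. 2 * fst p)"
      by (intro continuous_map_into_subtopology continuous_map_real_mult continuous_map_from_subtopology fst) auto
    from continuous_map_pairedI[OF this continuous_map_from_subtopology[OF continuous_map_snd]]
    show "continuous_map ?Y M (h \<circ> (\<lambda>p. (2 * fst p, snd p)))"
      by (rule continuous_map_compose[OF _ hD(1)])
    let ?Z = "subtopology ?X {p \<in> topspace ?X. 1 / 2 \<le> fst p}"
    have "continuous_map ?Z (top_of_set {0..1}) (\<lambda>p. 2 * fst p - 1)"
      by (intro continuous_map_into_subtopology continuous_map_diff continuous_map_real_mult
          continuous_map_from_subtopology fst) auto
    moreover have "continuous_map ?Z M (\<lambda>p. h (1, snd p))"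
      using continuous_map_compose[OF continuous_map_snd h1]
      by (intro continuous_map_from_subtopology) (simp add: o_def)
    ultimately show "continuous_map ?Z M (k \<circ> (\<lambda>p. (2 * fst p - 1, h (1, snd p))))"
      by (intro continuous_map_compose[OF _ kD(1)] continuous_map_pairedI)
  next
    fix p assume p: "p \<in> topspace ?X" "fst p = 1 / 2"
    then have "2 * fst p = 1" "snd p \<in> topspace M" by auto
    then show "(h \<circ> (\<lambda>p. (2 * fst p, snd p))) p = (k \<circ> (\<lambda>p. (2 * fst p - 1, h (1, snd p)))) p"
      using kD(3)[OF h1M] by simp
  qed (use fst in auto)
  moreover have "continuous_map M euclideanreal (\<lambda>x. \<psi> x + \<phi> (h (1, x)))"
    using continuous_map_compose[OF h1 kD(2)] by (intro continuous_map_add hD(2)) (simp add: o_def)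
  moreover have "l (0, x) = x \<and> 0 \<le> \<psi> x + \<phi> (h (1, x)) \<and> (\<psi> x + \<phi> (h (1, x)) = 0 \<longrightarrow> l (1, x) = x) \<and>
        (\<exists>I\<le>- (\<psi> x + \<phi> (h (1, x))). has_form_integral M A \<omega> (\<lambda>t. l (t, x)) I)"
    if x: "x \<in> topspace M" for x
  proof (intro conjI impI)
    note x1 = h1M[OF x]
    show "l (0, x) = x" using hD(3)[OF x] by (simp add: l_def)
    show "0 \<le> \<psi> x + \<phi> (h (1, x))" using hD(4)[OF x] kD(4)[OF x1] by simp
    show "l (1, x) = x" if "\<psi> x + \<phi> (h (1, x)) = 0"
    proof -
      have "\<psi> x = 0" "\<phi> (h (1, x)) = 0" using that hD(4)[OF x] kD(4)[OF x1] by auto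
      then show ?thesis using hD(5)[OF x] kD(5)[OF x1] by (simp add: l_def)
    qed
    obtain I where I: "I \<le> - \<psi> x" "has_form_integral M A \<omega> (\<lambda>t. h (t, x)) I"
      using hD(6)[OF x] by blast
    obtain J where J: "J \<le> - \<phi> (h (1, x))" "has_form_integral M A \<omega> (\<lambda>t. k (t, h (1, x))) J"
      using kD(6)[OF x1] by blast
    have "(\<lambda>t. if t \<le> 1 / 2 then h (2 * t, x) else k (2 * t - 1, h (1, x))) = (\<lambda>t. l (t, x))"
      by (auto simp: l_def)
    then have "has_form_integral M A \<omega> (\<lambda>t. l (t, x)) (I + J)"
      using has_form_integral_join[OF I(2) J(2)] kD(3)[OF x1] by simp
    then show "\<exists>I\<le>- (\<psi> x + \<phi> (h (1, x))). has_form_integral M A \<omega> (\<lambda>t. l (t, x)) I"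
      using I(1) J(1) by (intro exI[of _ "I + J"]) simp
  qed
  ultimately show "movement M A \<omega> l (\<lambda>x. \<psi> x + \<phi> (h (1, x)))"
    by (simp add: movement_def)
qed

section \<open>A movement supported near one point\<close>

lemma continuous_map_two_openin:
  assumes "openin X U" "openin X V" "topspace X \<subseteq> U \<union> V"
    and "continuous_map (subtopology X U) Y f" "continuous_map (subtopology X V) Y f"
  shows "continuous_map X Y f"
  by (rule pasting_lemma[where I = "UNIV" and T = "\<lambda>b. if b then U else V" and f = "\<lambda>_. f"])
     (use assms in \<open>auto split: if_splits\<close>)

text \<open>Mean value theorem along a segment. The parameter runs over the unit interval with
  \<open>r\<close> as a factor, so that the degenerate case \<open>r = 0\<close>, which occurs where
  the bump function vanishes, is included.\<close>

lemma has_derivative_decreasing_segment: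
  fixes g :: "'e::real_normed_vector \<Rightarrow> real"
  assumes r: "r \<ge> 0"
    and der: "\<And>s. 0 \<le> s \<Longrightarrow> s \<le> 1 \<Longrightarrow> (g has_derivative g' (y + (s * r) *\<^sub>R w)) (at (y + (s * r) *\<^sub>R w))"
    and neg: "\<And>s. 0 \<le> s \<Longrightarrow> s \<le> 1 \<Longrightarrow> g' (y + (s * r) *\<^sub>R w) w \<le> - \<kappa>"
  shows "g (y + r *\<^sub>R w) - g y \<le> - (\<kappa> * r)"
proof -
  define \<phi> where "\<phi> s = g (y + (s * r) *\<^sub>R w)" for s
  have "(\<phi> has_derivative (\<lambda>h. h * (r * g' (y + (s * r) *\<^sub>R w) w))) (at s within {0..1})"
    if "0 \<le> s" "s \<le> 1" for s
  proof -
    have G: "(g has_derivative g' (y + (s * r) *\<^sub>R w)) (at (y + (s * r) *\<^sub>R w))" using der that by auto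
    interpret G: bounded_linear "g' (y + (s * r) *\<^sub>R w)" using G by (rule has_derivative_bounded_linear)
    have "(\<phi> has_derivative (\<lambda>h. g' (y + (s * r) *\<^sub>R w) ((h * r) *\<^sub>R w))) (at s within {0..1})"
      unfolding \<phi>_def
      by (rule has_derivative_compose[where f = "\<lambda>s. y + (s * r) *\<^sub>R w" and x = s and g = g, OF _ G])
         (auto intro!: derivative_eq_intros)
    then show ?thesis by (simp add: G.scaleR mult.assoc)
  qed
  from mvt_simple[of 0 1, OF zero_less_one this]
  obtain s where s: "s \<in> {0<..<1}" "\<phi> 1 - \<phi> 0 = (1 - 0) * (r * g' (y + (s * r) *\<^sub>R w) w)" by blast
  have "r * g' (y + (s * r) *\<^sub>R w) w \<le> r * (- \<kappa>)"
    using neg[of s] s(1) r by (intro mult_left_mono) auto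
  then show ?thesis using s(2) by (simp add: \<phi>_def mult.commute)
qed

text \<open>On a small ball the form stays below \<open>- \<kappa>\<close> on a constant direction
  \<open>w\<close>, so a primitive there falls by at least \<open>\<kappa>\<close> times the length
  of a translation along \<open>w\<close>. This length tends to zero at the boundary of a smaller
  ball, beyond which the motion is extended by the identity.\<close>

lemma movement_at_point:
  assumes M: "smooth_manifold M A" and \<omega>: "closed_one_form A \<omega>"
    and c: "c \<in> A" "p \<in> fst c" and v: "\<omega> c (snd c p) v \<noteq> 0"
  obtains h \<psi> where "movement M A \<omega> h \<psi>" "\<psi> p > 0"
proof -
  note chc = smooth_manifold_is_chart[OF M c(1)]
  have of: "one_form A \<omega>" using \<omega> by (simp add: closed_one_form_def)
  define S where "S = snd c ` fst c"
  define y0 where "y0 = snd c p"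
  have S: "open S" unfolding S_def by (rule chart_open_image[OF chc])
  have y0: "y0 \<in> S" using c by (simp add: S_def y0_def)
  have lin: "linear (\<omega> c y)" if "y \<in> S" for y using of c that by (auto simp: one_form_def S_def)
  \<comment> \<open>The sign makes \<open>\<omega> c y0 w\<close> negative, and unit length makes
    \<open>\<rho>\<close> the distance travelled up to time \<open>1\<close>.\<close>
  define w where "w = - (sgn (\<omega> c y0 v) / norm v) *\<^sub>R v"
  have "v \<noteq> 0" using v linear_0[OF lin[OF y0]] by (auto simp: y0_def)
  then have nw: "norm w = 1" using v by (simp add: w_def y0_def abs_sgn_eq)
  \<comment> \<open>Half of the value at \<open>y0\<close>, so that a strict inequality holds there
    and persists nearby by continuity.\<close>
  define \<kappa> where "\<kappa> = - \<omega> c y0 w / 2"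
  have "\<omega> c y0 w = - (\<bar>\<omega> c y0 v\<bar> / norm v)"
    using linear_scale[OF lin[OF y0]] by (simp add: w_def linear_neg[OF lin[OF y0]] abs_sgn mult.commute)
  then have \<kappa>: "\<kappa> > 0" using v \<open>v \<noteq> 0\<close> by (simp add: \<kappa>_def y0_def)
  have "smooth_on S (\<lambda>y. \<omega> c y w)"
    using of c(1) by (auto simp: one_form_def S_def)
  then have "continuous_on S (\<lambda>y. \<omega> c y w)" by (rule smooth_on_continuous)
  then have "open (S \<inter> (\<lambda>y. \<omega> c y w) -` {..<- \<kappa>})"
    by (intro continuous_open_preimage S open_lessThan)
  moreover have "y0 \<in> S \<inter> (\<lambda>y. \<omega> c y w) -` {..<- \<kappa>}" using y0 \<kappa> by (auto simp: \<kappa>_def)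
  ultimately obtain r where r: "r > 0" "ball y0 r \<subseteq> S \<inter> (\<lambda>y. \<omega> c y w) -` {..<- \<kappa>}"
    by (rule openE)
  \<comment> \<open>The motion is confined to radius \<open>e\<close>, so that the closed ball of
    this radius still lies in the ball where the primitive is available.\<close>
  define e where "e = r / 2"
  have e: "e > 0" "r = 2 * e" using r by (auto simp: e_def)
  have BS: "ball y0 r \<subseteq> S" using r by auto
  define V where "V = {x \<in> fst c. snd c x \<in> ball y0 r}"
  have V: "openin M V" unfolding V_def by (rule chart_openin_vimage[OF chc]) simp
  obtain f where f: "primitive_on A \<omega> V f"
    using primitive_on_ball[OF M \<omega> c(1) BS[unfolded S_def] r(1)] unfolding V_def by blast
  have VM: "V \<subseteq> topspace M" using V openin_subset by blast
  \<comment> \<open>The room left before radius \<open>e\<close>: by the triangle inequality a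
    translation of at most this length carries no point of the smaller ball beyond that
    radius.\<close>
  define \<rho> where "\<rho> y = max 0 (e - dist y0 y)" for y
  define H where "H s y = y + (s * \<rho> y) *\<^sub>R w" for s y
  have Hball: "H s y \<in> ball y0 r" if "y \<in> ball y0 r" "0 \<le> s" "s \<le> 1" for s y
  proof (cases "dist y0 y < e")
    case True
    have "dist y0 (H s y) \<le> dist y0 y + dist y (H s y)" by (rule dist_triangle)
    also have "dist y (H s y) = s * \<rho> y" using that nw by (simp add: H_def dist_norm \<rho>_def)
    also have "s * \<rho> y \<le> 1 * \<rho> y" using that by (intro mult_right_mono) (auto simp: \<rho>_def)
    also have "dist y0 y + 1 * \<rho> y = e" using True by (simp add: \<rho>_def)
    finally show ?thesis using e by simp
  next
    case False
    then show ?thesis using that by (simp add: H_def \<rho>_def)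
  qed
  define h where "h = (\<lambda>(s, x). if x \<in> V then chart_inv c (H s (snd c x)) else x)"
  define \<psi> where "\<psi> x = (if x \<in> V then \<kappa> * \<rho> (snd c x) else 0)" for x
  \<comment> \<open>Compact in a Hausdorff space, hence closed. So \<open>V\<close> and the
    complement of \<open>K\<close> form an open cover; the chart formula gives continuity on the
    first set, and nothing moves on the second.\<close>
  define K where "K = chart_inv c ` cball y0 e"
  have cS: "cball y0 e \<subseteq> S" using BS e by (force simp: subset_iff)
  have "compactin M K"
    unfolding K_def
  proof (rule image_compactin[OF _ chart_inv_continuous[OF chc]])
    show "compactin (top_of_set (snd c ` fst c)) (cball y0 e)"
      using cS by (simp add: compactin_subtopology S_def)
  qed
  then have K: "closedin M K" using M compactin_imp_closedin by (auto simp: smooth_manifold_def)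
  have KV: "K \<subseteq> V"
  proof
    fix x assume "x \<in> K"
    then obtain y where y: "y \<in> cball y0 e" "x = chart_inv c y" by (auto simp: K_def)
    then show "x \<in> V" using cS e chart_inv_in[of y c] by (auto simp: V_def S_def)
  qed
  have \<rho>0: "\<rho> (snd c x) = 0" if "x \<in> V" "x \<notin> K" for x
  proof (rule ccontr)
    assume "\<rho> (snd c x) \<noteq> 0"
    then have "snd c x \<in> cball y0 e" by (auto simp: \<rho>_def max_def split: if_splits)
    then have "chart_inv c (snd c x) \<in> K" unfolding K_def by blast
    then show False using that chc by (auto simp: V_def)
  qed
  have hK: "h (s, x) = x" "\<psi> x = 0" if "x \<notin> K" for s x
    using that \<rho>0[of x] chc by (auto simp: h_def H_def \<psi>_def V_def)
  let ?X = "prod_topology (top_of_set {0..1::real}) M"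
  have ch: "continuous_map (subtopology M V) euclidean (snd c)"
    by (rule continuous_map_from_subtopology_mono[OF chart_continuous[OF chc]]) (auto simp: V_def)
  have "continuous_map M euclideanreal \<psi>"
  proof (rule continuous_map_two_openin[OF V openin_diff[OF openin_topspace K]])
    have "continuous_map (subtopology M V) euclidean ((\<lambda>y. \<kappa> * \<rho> y) \<circ> snd c)"
      by (rule continuous_map_compose[OF ch]) (auto simp: \<rho>_def intro!: continuous_intros)
    then show "continuous_map (subtopology M V) euclideanreal \<psi>"
      by (rule continuous_map_eq) (auto simp: \<psi>_def)
    have "continuous_map (subtopology M (topspace M - K)) euclideanreal (\<lambda>x. 0)" by simp
    then show "continuous_map (subtopology M (topspace M - K)) euclideanreal \<psi>"
      by (rule continuous_map_eq) (auto simp: hK)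
  qed (use KV in auto)
  moreover have "continuous_map ?X M h"
  proof (rule continuous_map_two_openin)
    show "openin ?X {q \<in> topspace ?X. snd q \<in> V}" "openin ?X {q \<in> topspace ?X. snd q \<in> topspace M - K}"
      by (rule openin_continuous_map_preimage[OF continuous_map_snd]; use V K in auto)+
    show "topspace ?X \<subseteq> {q \<in> topspace ?X. snd q \<in> V} \<union> {q \<in> topspace ?X. snd q \<in> topspace M - K}"
      using KV by auto
    let ?Y = "subtopology ?X {q \<in> topspace ?X. snd q \<in> V}"
    have "continuous_map ?Y (subtopology M V) snd"
      by (intro continuous_map_into_subtopology continuous_map_from_subtopology continuous_map_snd) auto
    from continuous_map_compose[OF this ch]
    have sn: "continuous_map ?Y euclidean (\<lambda>q. snd c (snd q))" by (simp add: o_def)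
    have fs: "continuous_map ?Y euclidean fst"
      using continuous_map_fst continuous_map_in_subtopology continuous_map_from_subtopology by blast
    have "continuous_map ?Y euclidean ((\<lambda>(s, y). H s y) \<circ> (\<lambda>q. (fst q, snd c (snd q))))"
    proof (rule continuous_map_compose)
      show "continuous_map ?Y (prod_topology euclidean euclidean) (\<lambda>q. (fst q, snd c (snd q)))"
        by (intro continuous_map_pairedI fs sn)
      have "continuous_on UNIV (\<lambda>q. H (fst q) (snd q))"
        unfolding H_def \<rho>_def by (intro continuous_intros)
      then show "continuous_map (prod_topology euclidean euclidean) euclidean (\<lambda>(s, y). H s y)"
        by (simp add: case_prod_beta')
    qed
    moreover have "H (fst q) (snd c (snd q)) \<in> snd c ` fst c" if "q \<in> topspace ?Y" for q
      using that Hball[of "snd c (snd q)" "fst q"] BS by (auto simp: V_def S_def)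
    ultimately have "continuous_map ?Y (top_of_set (snd c ` fst c)) (\<lambda>q. H (fst q) (snd c (snd q)))"
      by (auto simp: o_def intro!: continuous_map_into_subtopology)
    from continuous_map_compose[OF this chart_inv_continuous[OF chc]]
    show "continuous_map ?Y M h"
      by (rule continuous_map_eq) (auto simp: h_def)
    let ?Z = "subtopology ?X {q \<in> topspace ?X. snd q \<in> topspace M - K}"
    have "continuous_map ?Z M snd"
      by (intro continuous_map_from_subtopology continuous_map_snd)
    then show "continuous_map ?Z M h"
      by (rule continuous_map_eq) (auto simp: hK)
  qed
  moreover have "h (0, x) = x \<and> 0 \<le> \<psi> x \<and> (\<psi> x = 0 \<longrightarrow> h (1, x) = x) \<and>
        (\<exists>I\<le>- \<psi> x. has_form_integral M A \<omega> (\<lambda>t. h (t, x)) I)" if x: "x \<in> topspace M" for x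
  proof (intro conjI impI)
    show "h (0, x) = x" using chc by (auto simp: h_def H_def V_def)
    show "0 \<le> \<psi> x" using \<kappa> by (simp add: \<psi>_def \<rho>_def)
    show "h (1, x) = x" if "\<psi> x = 0"
      using that chc \<kappa> by (auto simp: h_def H_def V_def \<psi>_def split: if_splits)
    show "\<exists>I\<le>- \<psi> x. has_form_integral M A \<omega> (\<lambda>t. h (t, x)) I"
    proof (cases "x \<in> V")
      case True
      let ?y = "snd c x"
      have y: "?y \<in> ball y0 r" using True by (simp add: V_def)
      have hV: "h (t, x) \<in> V" if "t \<in> {0..1}" for t
        using True Hball[OF y, of t] that BS chart_inv_in[of "H t ?y" c] by (auto simp: h_def V_def S_def)
      have "f (h (1, x)) - f (h (0, x)) =
          (f \<circ> chart_inv c) (?y + \<rho> ?y *\<^sub>R w) - (f \<circ> chart_inv c) ?y"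
        using True by (simp add: h_def H_def)
      also have "\<dots> \<le> - (\<kappa> * \<rho> ?y)"
      proof (rule has_derivative_decreasing_segment[where g' = "\<omega> c"])
        fix s :: real assume s: "0 \<le> s" "s \<le> 1"
        have b: "?y + (s * \<rho> ?y) *\<^sub>R w \<in> ball y0 r" using Hball[OF y s] by (simp add: H_def)
        then have "?y + (s * \<rho> ?y) *\<^sub>R w \<in> snd c ` (fst c \<inter> V)"
          using BS b by (force simp: V_def S_def image_iff)
        then show "(f \<circ> chart_inv c has_derivative \<omega> c (?y + (s * \<rho> ?y) *\<^sub>R w)) (at (?y + (s * \<rho> ?y) *\<^sub>R w))"
          using f c(1) primitive_on_iff[OF M of V] by blast
        show "\<omega> c (?y + (s * \<rho> ?y) *\<^sub>R w) w \<le> - \<kappa>" using b r(2) by force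
      qed (simp add: \<rho>_def)
      finally have "f (h (1, x)) - f (h (0, x)) \<le> - \<psi> x" using True by (simp add: \<psi>_def)
      moreover have "has_form_integral M A \<omega> (\<lambda>t. h (t, x)) (f (h (1, x)) - f (h (0, x)))"
        by (rule has_form_integral_within_primitive[OF V f]) (use hV in auto)
      ultimately show ?thesis by blast
    next
      case False
      then have "(\<lambda>t. h (t, x)) = (\<lambda>t. snd (t, x))" "\<psi> x = 0" by (auto simp: h_def \<psi>_def)
      then show ?thesis using movementD(6)[OF movement_id[OF M \<omega>] x] by simp
    qed
  qed
  ultimately have "movement M A \<omega> h \<psi>" by (simp add: movement_def)
  moreover have "\<psi> p > 0" using \<kappa> e c r by (simp add: \<psi>_def V_def \<rho>_def y0_def)
  ultimately show thesis by (rule that)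
qed

text \<open>Compactness enters twice: finitely many local movements give a composite that is strict
  everywhere, and its continuous \<open>\<psi>\<close> then attains a positive minimum.\<close>

lemma uniform_movement:
  assumes M: "smooth_manifold M A" and \<omega>: "closed_one_form A \<omega>" and cpt: "compact_space M"
    and nz: "\<And>c y. c \<in> A \<Longrightarrow> y \<in> snd c ` fst c \<Longrightarrow> \<exists>v. \<omega> c y v \<noteq> 0"
  obtains h \<psi> \<delta> where "movement M A \<omega> h \<psi>" "\<delta> > 0" "\<And>x. x \<in> topspace M \<Longrightarrow> \<delta> \<le> \<psi> x"
proof -
  have "\<exists>h \<psi>. movement M A \<omega> h \<psi> \<and> \<psi> p > 0" if p: "p \<in> topspace M" for p
  proof -
    obtain c where c: "c \<in> A" "p \<in> fst c" using chart_at_point[OF M p] .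
    then obtain v where "\<omega> c (snd c p) v \<noteq> 0" using nz by blast
    from movement_at_point[OF M \<omega> c this] show ?thesis by blast
  qed
  then obtain H \<Psi> where H: "\<And>p. p \<in> topspace M \<Longrightarrow> movement M A \<omega> (H p) (\<Psi> p) \<and> \<Psi> p p > 0" by metis
  define W where "W p = {x \<in> topspace M. \<Psi> p x \<in> {0<..}}" for p
  have W: "openin M (W p)" if "p \<in> topspace M" for p
    unfolding W_def
    by (rule openin_continuous_map_preimage[OF movementD(2)]) (use H[OF that] in auto)
  have "topspace M \<subseteq> \<Union> (W ` topspace M)" using H by (auto simp: W_def)
  then obtain \<F> where \<F>: "finite \<F>" "\<F> \<subseteq> W ` topspace M" "topspace M \<subseteq> \<Union>\<F>"
    using cpt W unfolding compact_space_alt by (metis (no_types, lifting) imageE)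
  then obtain P where P: "finite P" "P \<subseteq> topspace M" "\<F> = W ` P"
    using finite_subset_image by metis
  from P(1,2) have "\<exists>h \<psi>. movement M A \<omega> h \<psi> \<and> (\<forall>p\<in>P. \<forall>x\<in>W p. \<psi> x > 0)"
  proof (induction P rule: finite_induct)
    case empty
    show ?case using movement_id[OF M \<omega>] by blast
  next
    case (insert p P)
    then obtain h \<psi> where h: "movement M A \<omega> h \<psi>" "\<And>q x. q \<in> P \<Longrightarrow> x \<in> W q \<Longrightarrow> \<psi> x > 0" by auto
    have p: "movement M A \<omega> (H p) (\<Psi> p)" using H insert.prems by auto
    obtain l where l: "movement M A \<omega> l (\<lambda>x. \<psi> x + \<Psi> p (h (1, x)))"
      using movement_compose[OF h(1) p] .
    have "\<psi> x + \<Psi> p (h (1, x)) > 0" if q: "q \<in> insert p P" "x \<in> W q" for q x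
    proof -
      have x: "x \<in> topspace M" using q by (simp add: W_def)
      have h1: "h (1, x) \<in> topspace M"
        using continuous_map_homotopy_slice[OF movementD(1)[OF h(1)], of 1] x
        by (auto simp: continuous_map_def)
      have ge: "\<psi> x \<ge> 0" "\<Psi> p (h (1, x)) \<ge> 0"
        using movementD(4)[OF h(1) x] movementD(4)[OF p h1] .
      \<comment> \<open>Where \<open>h\<close> is not strict it ends at \<open>x\<close> itself, so
        the value of \<open>\<Psi> p\<close> at \<open>h (1, x)\<close> is its positive value at
        \<open>x\<close>.\<close>
      show ?thesis
      proof (cases "\<psi> x = 0")
        case True
        then have "h (1, x) = x" using movementD(5)[OF h(1) x] by blast
        moreover have "q = p" using h(2)[of q x] q True by auto
        ultimately show ?thesis using q True by (simp add: W_def)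
      qed (use ge in simp)
    qed
    then show ?case using l by blast
  qed
  then obtain h \<psi> where h: "movement M A \<omega> h \<psi>" "\<And>p x. p \<in> P \<Longrightarrow> x \<in> W p \<Longrightarrow> \<psi> x > 0" by blast
  have pos: "\<psi> x > 0" if "x \<in> topspace M" for x using h(2) \<F>(3) P(3) that by blast
  show thesis
  proof (cases "topspace M = {}")
    \<comment> \<open>On the empty space there is no minimum to take; any positive
      \<open>\<delta>\<close> works.\<close>
    case True
    then show thesis using that[OF h(1) zero_less_one] by simp
  next
    case False
    have "compact (\<psi> ` topspace M)"
      using image_compactin[OF _ movementD(2)[OF h(1)]] cpt by (simp add: compact_space_def)
    then obtain x where "x \<in> topspace M" "\<And>y. y \<in> topspace M \<Longrightarrow> \<psi> x \<le> \<psi> y"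
      using compact_attains_inf[of "\<psi> ` topspace M"] False by auto
    then show thesis using that[OF h(1)] pos by blast
  qed
qed

text \<open>Each repetition starts at a new point; since the lower bound for \<open>\<psi>\<close>
  holds at all points, the drops add up.\<close>

lemma movement_iterate:
  assumes M: "smooth_manifold M A" and \<omega>: "closed_one_form A \<omega>"
    and h: "movement M A \<omega> h \<psi>" "\<And>x. x \<in> topspace M \<Longrightarrow> \<delta> \<le> \<psi> x"
  shows "\<exists>k \<phi>. movement M A \<omega> k \<phi> \<and> (\<forall>x\<in>topspace M. real n * \<delta> \<le> \<phi> x)"
proof (induction n)
  case 0
  show ?case using movement_id[OF M \<omega>] by auto
next
  case (Suc n)
  then obtain k \<phi> where k: "movement M A \<omega> k \<phi>" "\<And>x. x \<in> topspace M \<Longrightarrow> real n * \<delta> \<le> \<phi> x" by blast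
  obtain l where l: "movement M A \<omega> l (\<lambda>x. \<psi> x + \<phi> (h (1, x)))"
    using movement_compose[OF h(1) k(1)] .
  have "real (Suc n) * \<delta> \<le> \<psi> x + \<phi> (h (1, x))" if x: "x \<in> topspace M" for x
  proof -
    have "h (1, x) \<in> topspace M"
      using continuous_map_homotopy_slice[OF movementD(1)[OF h(1)], of 1] x
      by (auto simp: continuous_map_def)
    from k(2)[OF this] h(2)[OF x] show ?thesis by (simp add: algebra_simps)
  qed
  with l show ?case by blast
qed

section \<open>Category zero for classes with a nowhere vanishing representative\<close>

lemma smooth_function_continuous_map:
  assumes M: "smooth_manifold M A" and g: "smooth_function A (topspace M) g"
  shows "continuous_map M euclideanreal g"
proof (rule pasting_lemma[where I = A and T = fst and f = "\<lambda>_. g"])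
  show "\<exists>c. c \<in> A \<and> x \<in> fst c \<and> g x = g x" if "x \<in> topspace M" for x
    using chart_at_point[OF M that] by blast
  show "continuous_map (subtopology M (fst c)) euclideanreal g" if c: "c \<in> A" for c
  proof -
    note chc = smooth_manifold_is_chart[OF M c]
    have sub: "fst c \<subseteq> topspace M" using chart_openin[OF chc] openin_subset by blast
    then have "fst c \<inter> topspace M = fst c" by blast
    then have "smooth_on (snd c ` fst c) (g \<circ> chart_inv c)"
      using g c unfolding smooth_function_def by metis
    then have "continuous_map (top_of_set (snd c ` fst c)) euclideanreal (g \<circ> chart_inv c)"
      by (simp only: continuous_map_iff_continuous smooth_on_continuous)
    moreover have "continuous_map (subtopology M (fst c)) (top_of_set (snd c ` fst c)) (snd c)"
      by (rule continuous_map_into_subtopology[OF chart_continuous[OF chc]]) auto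
    ultimately have "continuous_map (subtopology M (fst c)) euclideanreal ((g \<circ> chart_inv c) \<circ> snd c)"
      by (rule continuous_map_compose[rotated])
    then show ?thesis by (rule continuous_map_eq) (use chc in auto)
  qed
qed (use chart_openin[OF smooth_manifold_is_chart[OF M]] in auto)

text \<open>Taking \<open>F\<close> to be the whole space leaves an empty family of null-homotopic
  sets. The form \<open>\<eta>\<close> may have zeros, so the homotopy is made for
  \<open>\<omega>\<close> and its integrals are corrected by the increments of the bounded function
  \<open>g\<close>.\<close>

theorem has_cat_covers_0_if_nowhere_zero:
  assumes M: "smooth_manifold M A" and cpt: "compact_space M" and \<omega>: "closed_one_form A \<omega>"
    and nz: "\<And>c y. c \<in> A \<Longrightarrow> y \<in> snd c ` fst c \<Longrightarrow> \<exists>v. \<omega> c y v \<noteq> 0"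
    and \<eta>: "(\<omega>, \<eta>) \<in> cohomologous M A"
  shows "has_cat_covers M A \<eta> 0"
proof -
  have of: "one_form A \<omega>" and \<eta>c: "closed_one_form A \<eta>" and oe: "one_form A \<eta>"
    using \<omega> \<eta> by (auto simp: cohomologous_def closed_one_form_def)
  obtain g where g: "smooth_function A (topspace M) g"
    "\<And>c x v. c \<in> A \<Longrightarrow> x \<in> snd c ` fst c \<Longrightarrow> \<eta> c x v = \<omega> c x v + d0 g c x v"
    using \<eta> unfolding cohomologous_def by blast
  have "compact (g ` topspace M)"
    using image_compactin[OF _ smooth_function_continuous_map[OF M g(1)]] cpt by (simp add: compact_space_def)
  then obtain B where B: "\<And>x. x \<in> topspace M \<Longrightarrow> \<bar>g x\<bar> \<le> B"
    using compact_imp_bounded[of "g ` topspace M"] unfolding bounded_iff by auto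
  obtain h \<psi> \<delta> where h: "movement M A \<omega> h \<psi>" "\<delta> > 0" "\<And>x. x \<in> topspace M \<Longrightarrow> \<delta> \<le> \<psi> x"
    using uniform_movement[OF M \<omega> cpt nz] by metis
  have "movable M A \<eta> N (topspace M)" for N
  proof -
    \<comment> \<open>The term \<open>2 * B\<close> absorbs the difference of \<open>g\<close>
      between the end points of the path.\<close>
    obtain n :: nat where n: "N + 2 * B < real n * \<delta>" using reals_Archimedean3[OF h(2)] by blast
    obtain k \<phi> where k: "movement M A \<omega> k \<phi>" "\<And>x. x \<in> topspace M \<Longrightarrow> real n * \<delta> \<le> \<phi> x"
      using movement_iterate[OF M \<omega> h(1,3)] by metis
    have "form_integral M A \<eta> (\<lambda>t. k (t, x)) \<le> - N" if x: "x \<in> topspace M" for x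
    proof -
      obtain I where I: "I \<le> - \<phi> x" "has_form_integral M A \<omega> (\<lambda>t. k (t, x)) I"
        using movementD(6)[OF k(1) x] by blast
      have "form_integral M A \<eta> (\<lambda>t. k (t, x)) = I + (g (k (1, x)) - g (k (0, x)))"
        by (rule form_integral_eq[OF M \<eta>c pathin_homotopy[OF movementD(1)[OF k(1)] x]])
           (rule has_form_integral_add_exact[OF M of oe g I(2)])
      moreover have "k (1, x) \<in> topspace M" "k (0, x) \<in> topspace M"
        using continuous_map_homotopy_slice[OF movementD(1)[OF k(1)], of 1]
          continuous_map_homotopy_slice[OF movementD(1)[OF k(1)], of 0] x
        by (auto simp: continuous_map_def)
      ultimately show ?thesis
        using B[of "k (1, x)"] B[of "k (0, x)"] k(2)[OF x] I(1) n by linarith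
    qed
    then show ?thesis
      using movementD(1,3)[OF k(1)] by (auto simp: movable_def intro!: exI[of _ k])
  qed
  then show ?thesis by (auto simp: has_cat_covers_def intro!: exI[of _ "topspace M"])
qed

subsection \<open>The pairing of the Lee form with an infinitesimal automorphism\<close>

lemma connected_space_locally_constant:
  assumes con: "connected_space M"
    and loc: "\<And>x. x \<in> topspace M \<Longrightarrow> \<exists>W. openin M W \<and> x \<in> W \<and> (\<forall>y\<in>W. f y = f x)"
    and xy: "x \<in> topspace M" "y \<in> topspace M"
  shows "f x = f y"
proof (rule ccontr)
  assume ne: "f x \<noteq> f y"
  let ?U = "{z \<in> topspace M. f z = f x}" and ?V = "{z \<in> topspace M. f z \<noteq> f x}"
  have op: "openin M {z \<in> topspace M. P (f z)}" for P
  proof (subst openin_subopen, intro ballI)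
    fix z assume "z \<in> {z \<in> topspace M. P (f z)}"
    then have z: "z \<in> topspace M" "P (f z)" by auto
    from loc[OF z(1)] obtain W where W: "openin M W" "z \<in> W" "\<forall>y\<in>W. f y = f z" by blast
    have "W \<subseteq> {z \<in> topspace M. P (f z)}"
    proof
      fix y assume y: "y \<in> W"
      then have "y \<in> topspace M" using openin_subset[OF W(1)] by blast
      then show "y \<in> {z \<in> topspace M. P (f z)}" using bspec[OF W(3) y] z(2) by simp
    qed
    then show "\<exists>T. openin M T \<and> z \<in> T \<and> T \<subseteq> {z \<in> topspace M. P (f z)}"
      using W(1,2) by blast
  qed
  have "openin M ?U" "openin M ?V"
    by (fact op[of "\<lambda>t. t = f x"], fact op[of "\<lambda>t. t \<noteq> f x"])
  moreover have "topspace M \<subseteq> ?U \<union> ?V" "?U \<inter> ?V = {}" by auto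
  moreover have "x \<in> ?U" using xy(1) by simp
  then have "?U \<noteq> {}" by blast
  moreover have "y \<in> ?V" using xy(2) ne[symmetric] by simp
  then have "?V \<noteq> {}" by blast
  ultimately have "\<not> connected_space M"
    unfolding connected_space_def not_not by - (intro exI[of _ ?U] exI[of _ ?V] conjI; assumption)
  then show False using con by contradiction
qed

text \<open>The computation in the model space gives derivative zero in each chart separately. The
  transformation laws of \<open>\<theta>\<close> and \<open>X\<close> combine the local pairings
  into one function \<open>F\<close> on the space, to which connectedness applies.\<close>

lemma infinitesimal_automorphism_lee_pairing_constant:
  fixes M :: "'a topology" and A :: "('a, 'e::euclidean_space) chart set"
  assumes lcs: "lcs_manifold M A \<Omega> \<theta>" and con: "connected_space M"
    and X: "X \<in> infinitesimal_automorphisms A \<Omega>"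
  obtains r where "\<And>c x. c \<in> A \<Longrightarrow> x \<in> snd c ` fst c \<Longrightarrow> \<theta> c x (X c x) = r"
proof -
  have M: "smooth_manifold M A" and dim: "DIM('e) \<ge> 3" and \<Omega>: "two_form A \<Omega>" "nondegenerate A \<Omega>"
    and \<theta>: "closed_one_form A \<theta>" "one_form A \<theta>"
    and d\<Omega>: "\<And>c x u v w. c \<in> A \<Longrightarrow> x \<in> snd c ` fst c \<Longrightarrow> d2 \<Omega> c x u v w = wedge12 \<theta> \<Omega> c x u v w"
    using lcs by (auto simp: lcs_manifold_def closed_one_form_def)
  have vf: "vector_field A X"
    and L: "\<And>c x v w. c \<in> A \<Longrightarrow> x \<in> snd c ` fst c \<Longrightarrow> lie_derivative2 X \<Omega> c x v w = 0"
    using X by (auto simp: infinitesimal_automorphisms_def)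
  have der: "((\<lambda>y. \<theta> c y (X c y)) has_derivative (\<lambda>u. 0)) (at x)" if c: "c \<in> A" and x: "x \<in> snd c ` fst c" for c x
  proof (rule lee_pairing_has_derivative_0[where \<Omega> = "\<Omega> c", OF dim _ x])
    show "open (snd c ` fst c)" by (rule chart_open_image[OF smooth_manifold_is_chart[OF M c]])
    show "bilinear (\<Omega> c y)" "\<Omega> c y v v = 0" if "y \<in> snd c ` fst c" for y v
      using \<Omega>(1) c that unfolding two_form_def by blast+
    show "smooth_on (snd c ` fst c) (\<lambda>y. \<Omega> c y v w)" for v w
      using \<Omega>(1) c unfolding two_form_def by blast
    show "v = 0" if "\<forall>w. \<Omega> c x v w = 0" for v
      using \<Omega>(2) c x that unfolding nondegenerate_def by blast
    show "linear (\<theta> c y)" if "y \<in> snd c ` fst c" for y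
      using \<theta>(2) c that unfolding one_form_def by blast
    show "smooth_on (snd c ` fst c) (\<lambda>y. \<theta> c y v)" for v
      using \<theta>(2) c unfolding one_form_def by blast
    show "frechet_derivative (\<lambda>y. \<theta> c y v) (at x) u = frechet_derivative (\<lambda>y. \<theta> c y u) (at x) v" for u v
    proof -
      have "d1 \<theta> c x u v = 0" using \<theta>(1) c x unfolding closed_one_form_def by blast
      then show ?thesis by (simp add: d1_def)
    qed
    show "smooth_on (snd c ` fst c) (X c)" using vf c unfolding vector_field_def by blast
    show "frechet_derivative (\<lambda>z. \<Omega> c z v w) (at y) u - frechet_derivative (\<lambda>z. \<Omega> c z u w) (at y) v
        + frechet_derivative (\<lambda>z. \<Omega> c z u v) (at y) w
        = \<theta> c y u * \<Omega> c y v w - \<theta> c y v * \<Omega> c y u w + \<theta> c y w * \<Omega> c y u v"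
      if "y \<in> snd c ` fst c" for y u v w
      using d\<Omega>[OF c that, of u v w] by (simp add: d2_def wedge12_def)
    show "frechet_derivative (\<lambda>z. \<Omega> c z v w) (at y) (X c y) + \<Omega> c y (frechet_derivative (X c) (at y) v) w
        + \<Omega> c y v (frechet_derivative (X c) (at y) w) = 0"
      if "y \<in> snd c ` fst c" for y v w
      using L[OF c that, of v w] by (simp add: lie_derivative2_def)
  qed
  \<comment> \<open>The chart at \<open>p\<close> is arbitrary; the next fact shows that every chart
    containing \<open>p\<close> gives the same value.\<close>
  define F where "F p = (let c = SOME c. c \<in> A \<and> p \<in> fst c in \<theta> c (snd c p) (X c (snd c p)))" for p
  have F: "F p = \<theta> c (snd c p) (X c (snd c p))" if c: "c \<in> A" "p \<in> fst c" for c p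
  proof -
    define d where "d = (SOME c. c \<in> A \<and> p \<in> fst c)"
    have d: "d \<in> A" "p \<in> fst d" using someI[of "\<lambda>c. c \<in> A \<and> p \<in> fst c" c] c by (auto simp: d_def)
    have p: "snd d p \<in> snd d ` (fst d \<inter> fst c)" using c d by blast
    have t: "transition d c (snd d p) = snd c p"
      using d smooth_manifold_is_chart[OF M d(1)] by (simp add: transition_def)
    have "X c (snd c p) = frechet_derivative (transition d c) (at (snd d p)) (X d (snd d p))"
      using vf c(1) d(1) p t unfolding vector_field_def by metis
    moreover have "\<theta> d (snd d p) (X d (snd d p)) = \<theta> c (transition d c (snd d p))
        (frechet_derivative (transition d c) (at (snd d p)) (X d (snd d p)))"
      using \<theta>(2) c(1) d(1) p unfolding one_form_def by blast
    ultimately show ?thesis by (simp add: F_def d_def[symmetric] t)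
  qed
  have loc: "\<exists>W. openin M W \<and> p \<in> W \<and> (\<forall>q\<in>W. F q = F p)" if p: "p \<in> topspace M" for p
  proof -
    obtain c where c: "c \<in> A" "p \<in> fst c" using chart_at_point[OF M p] .
    note chc = smooth_manifold_is_chart[OF M c(1)]
    have "snd c p \<in> snd c ` fst c" using c by blast
    then obtain e where e: "e > 0" "ball (snd c p) e \<subseteq> snd c ` fst c"
      by (rule openE[OF chart_open_image[OF chc]])
    have "\<exists>k. \<forall>y\<in>ball (snd c p) e. \<theta> c y (X c y) = k"
      by (rule has_derivative_zero_constant[OF convex_ball])
         (use der[OF c(1)] e in \<open>blast intro: has_derivative_at_withinI\<close>)
    then obtain k where k: "\<And>y. y \<in> ball (snd c p) e \<Longrightarrow> \<theta> c y (X c y) = k" by blast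
    show ?thesis
    proof (intro exI conjI ballI)
      show "openin M {x \<in> fst c. snd c x \<in> ball (snd c p) e}"
        by (rule chart_openin_vimage[OF chc]) simp
      show "F q = F p" if "q \<in> {x \<in> fst c. snd c x \<in> ball (snd c p) e}" for q
        using F[OF c] F[OF c(1), of q] k[of "snd c q"] k[of "snd c p"] that e by simp
    qed (use c e in simp)
  qed
  \<comment> \<open>Choosing the reference point by \<open>SOME\<close> names the constant without a
    separate case for the empty space, where the claim is vacuous.\<close>
  have const: "F p = F (SOME q. q \<in> topspace M)" if "p \<in> topspace M" for p
    using connected_space_locally_constant[OF con loc that] someI[of "\<lambda>q. q \<in> topspace M", OF that] by blast
  show thesis
  proof (rule that)
    fix c x assume c: "c \<in> A" and x: "x \<in> snd c ` fst c"
    then obtain p where p: "p \<in> fst c" "x = snd c p" by blast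
    have "p \<in> topspace M"
      using p(1) chart_openin[OF smooth_manifold_is_chart[OF M c]] openin_subset by blast
    then show "\<theta> c x (X c x) = F (SOME q. q \<in> topspace M)" using const F[OF c p(1)] p(2) by simp
  qed
qed

text \<open>The point \<open>x\<close> excludes a second constant, so \<open>lee_hom\<close> is the
  value of the pairing, and \<open>X c x\<close> is a vector on which \<open>\<theta>\<close> does
  not vanish.\<close>

lemma lcs_first_kind_lee_form_nonzero:
  assumes lcs: "lcs_manifold M A \<Omega> \<theta>" and con: "connected_space M"
    and fk: "lcs_first_kind A \<Omega> \<theta>" and c: "c \<in> A" "x \<in> snd c ` fst c"
  shows "\<exists>v. \<theta> c x v \<noteq> 0"
proof -
  obtain X where X: "X \<in> infinitesimal_automorphisms A \<Omega>" "lee_hom A \<theta> X \<noteq> 0"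
    using fk by (auto simp: lcs_first_kind_def)
  obtain r where r: "\<And>c x. c \<in> A \<Longrightarrow> x \<in> snd c ` fst c \<Longrightarrow> \<theta> c x (X c x) = r"
    using infinitesimal_automorphism_lee_pairing_constant[OF lcs con X(1)] by blast
  have "lee_hom A \<theta> X = r"
    unfolding lee_hom_def
  proof (rule the_equality)
    show "\<forall>c\<in>A. \<forall>x\<in>snd c ` fst c. \<theta> c x (X c x) = r" using r by blast
    show "s = r" if "\<forall>c\<in>A. \<forall>x\<in>snd c ` fst c. \<theta> c x (X c x) = s" for s
      using bspec[OF bspec[OF that c(1)] c(2)] r[OF c] by simp
  qed
  then have "\<theta> c x (X c x) \<noteq> 0" using X(2) r[OF c] by simp
  then show ?thesis by blast
qed

text \<open>This makes the class nonempty, so that the representative picked by \<open>SOME\<close>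
  lies in it.\<close>

lemma closed_one_form_cohomologous_refl:
  assumes "closed_one_form A \<omega>"
  shows "(\<omega>, \<omega>) \<in> cohomologous M A"
proof -
  have Ck: "Ck_on k S (\<lambda>x::'b. 0::real)" for k S
    by (induction k) auto
  have "smooth_function A (topspace M) (\<lambda>x. 0)"
    using Ck by (simp add: smooth_function_def smooth_on_def o_def)
  moreover have "d0 (\<lambda>x. 0) c x v = 0" for c :: "('a, 'b) chart" and x v
    by (simp add: d0_def o_def)
  ultimately show ?thesis
    using assms unfolding cohomologous_def by fastforce
qed

theorem corollary3p2:
  fixes M :: "'a topology"
    and A :: "('a, 'e::euclidean_space) chart set"
    and \<Omega> :: "('a, 'e) form2"
    and \<theta> :: "('a, 'e) form1"
  assumes "lcs_manifold M A \<Omega> \<theta>"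
    and "compact_space M" and "connected_space M"
    and "lcs_first_kind A \<Omega> \<theta>"
  shows "class_cat M A (cohomology_class M A \<theta>) = 0"
proof -
  have M: "smooth_manifold M A" and \<theta>: "closed_one_form A \<theta>"
    using assms(1) by (auto simp: lcs_manifold_def)
  have "\<theta> \<in> cohomology_class M A \<theta>"
    using closed_one_form_cohomologous_refl[OF \<theta>] by (simp add: cohomology_class_def)
  then have "(SOME \<omega>. \<omega> \<in> cohomology_class M A \<theta>) \<in> cohomology_class M A \<theta>"
    by (rule someI[where P = "\<lambda>\<omega>. \<omega> \<in> cohomology_class M A \<theta>"])
  then have "has_cat_covers M A (SOME \<omega>. \<omega> \<in> cohomology_class M A \<theta>) 0"
    using has_cat_covers_0_if_nowhere_zero[OF M assms(2) \<theta>]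
      lcs_first_kind_lee_form_nonzero[OF assms(1,3,4)] by (simp add: cohomology_class_def)
  then have "class_cat M A (cohomology_class M A \<theta>) \<le> enat 0"
    unfolding class_cat_def by (intro INF_lower) simp
  \<comment> \<open>In \<open>enat\<close> the value \<open>0\<close> is the least element, so the
    upper bound is an equality.\<close>
  then show ?thesis by (simp flip: zero_enat_def)
qed

end
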